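(* Let $d\ge2$, $\varrho>0$, $\gamma>-\tfrac12$ and $w_{0,\gamma}(t)=|t|(t^2-\varrho^2)^{-\frac12}(1+\varrho^2-t^2)^{\gamma-\frac12}$ for $\varrho\le|t|\le\sqrt{\varrho^2+1}$. For every $n=0,1,2,\ldots$, every $u\in\mathcal V_n^E(\mathbb V_0^{d+1},w_{0,\gamma})$ satisfies $$\Big[(1+\varrho^2-t^2)\Big(1-\frac{\varrho^2}{t^2}\Big)\partial_t^2+\Big((1+\varrho^2-t^2)\frac{\varrho^2}{t^2}-(2\gamma+d)(t^2-\varrho^2)\Big)\frac1t\partial_t+\frac{d-1}{t}\partial_t+\frac1{t^2-\varrho^2}\Delta_0^{(x)}\Big]u=-n(n+2\gamma+d-1)u .$$
   Context: $\mathbb V_0^{d+1}=\{(x,t)\in\mathbb R^d\times\mathbb R:\ \|x\|^2=t^2-\varrho^2,\ \varrho\le|t|\le\sqrt{\varrho^2+1}\}$ is the finite double hyperboloid. Integration over it means $\int_{\mathbb V_0^{d+1}}f\,d\sigma=\int_{\varrho\le|t|\le\sqrt{\varrho^2+1}}(t^2-\varrho^2)^{\frac{d-1}2}\int_{\mathbb S^{d-1}}f(\sqrt{t^2-\varrho^2}\,\xi,t)\,d\sigma(\xi)\,dt$, with $d\sigma(\xi)$ the surface measure of the unit sphere $\mathbb S^{d-1}$. For an even weight $w$, $\langle f,g\rangle_w=\int_{\mathbb V_0^{d+1}}f\,g\,w(t)\,d\sigma(x,t)$, and $\mathcal V_n^E(\mathbb V_0^{d+1},w)$ is the space of (restrictions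 to $\mathbb V_0^{d+1}$ of) polynomials in $(x,t)$ of degree at most $n$ that are even in $t$, i.e. $u(x,-t)=u(x,t)$, and orthogonal with respect to $\langle\cdot,\cdot\rangle_w$ to all polynomials of degree at most $n-1$. The differential operators are understood in the coordinates $(\xi,t)$, $x=\sqrt{t^2-\varrho^2}\,\xi$, $\xi\in\mathbb S^{d-1}$, $|t|>\varrho$: $\partial_t$ is the derivative in $t$ with $\xi$ fixed, and $\Delta_0^{(x)}$ is the Laplace–Beltrami operator of $\mathbb S^{d-1}$ acting on $\xi$. *)

theory Defs
  imports "HOL-Analysis.Analysis"
begin

text \<open>
  Points of \<open>\<real>\<^sup>d \<times> \<real>\<close> have type \<open>(real^'d) \<times> real\<close> with \<open>d = CARD('d)\<close>; \<open>\<rho>\<close> is the parameter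
  \<open>\<varrho>\<close> of the hyperboloid.
\<close>

definition hyperboloid :: "real \<Rightarrow> ((real^'d) \<times> real) set" where
  "hyperboloid \<rho> = {(x, t). (norm x)\<^sup>2 = t\<^sup>2 - \<rho>\<^sup>2 \<and> \<rho> \<le> \<bar>t\<bar> \<and> \<bar>t\<bar> \<le> sqrt (\<rho>\<^sup>2 + 1)}"

text \<open>
  The surface measure of the unit sphere, defined from Lebesgue measure by polar coordinates:
  \<open>\<sigma>(A) = d \<cdot> vol {r\<xi> | 0 < r \<le> 1, \<xi> \<in> A}\<close>. On nonzero vectors, \<open>sgn x = x / \<parallel>x\<parallel>\<close>.
\<close>

definition sphere_measure :: "(real^'d) measure" where
  "sphere_measure =
     scale_measure (of_nat CARD('d))
       (distr (restrict_space lborel (cball 0 1 - {0})) (restrict_space borel (sphere 0 1)) sgn)"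

definition hyperboloid_integral :: "real \<Rightarrow> ((real^'d) \<times> real \<Rightarrow> real) \<Rightarrow> real" where
  "hyperboloid_integral \<rho> f =
     (LINT t:{t. \<rho> \<le> \<bar>t\<bar> \<and> \<bar>t\<bar> \<le> sqrt (\<rho>\<^sup>2 + 1)}|lborel.
        (t\<^sup>2 - \<rho>\<^sup>2) powr ((real CARD('d) - 1) / 2) *
        (LINT \<xi>|sphere_measure. f (sqrt (t\<^sup>2 - \<rho>\<^sup>2) *\<^sub>R \<xi>, t)))"

definition weighted_inner ::
  "real \<Rightarrow> (real \<Rightarrow> real) \<Rightarrow> ((real^'d) \<times> real \<Rightarrow> real) \<Rightarrow> ((real^'d) \<times> real \<Rightarrow> real) \<Rightarrow> real" where
  "weighted_inner \<rho> w f g = hyperboloid_integral \<rho> (\<lambda>(x, t). f (x, t) * g (x, t) * w t)"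

definition polynomials_upto :: "nat \<Rightarrow> ((real^'d) \<times> real \<Rightarrow> real) set" where
  "polynomials_upto n =
     {p. \<exists>c :: ('d \<Rightarrow> nat) \<Rightarrow> nat \<Rightarrow> real. \<forall>x t.
           p (x, t) = (\<Sum>(\<alpha>, k)\<in>{(\<alpha>, k). (\<Sum>i\<in>UNIV. \<alpha> i) + k \<le> n}.
                         c \<alpha> k * (\<Prod>i\<in>UNIV. (x $ i) ^ \<alpha> i) * t ^ k)}"

text \<open>
  Only the values of \<open>u\<close> on the hyperboloid matter. Orthogonality to all polynomials of degree
  at most \<open>n - 1\<close> is phrased with \<open>m < n\<close>, so that it is void for \<open>n = 0\<close>.
\<close>

definition even_ortho_polys ::
  "real \<Rightarrow> (real \<Rightarrow> real) \<Rightarrow> nat \<Rightarrow> ((real^'d) \<times> real \<Rightarrow> real) set" where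
  "even_ortho_polys \<rho> w n =
     {u. (\<exists>p\<in>polynomials_upto n. \<forall>z\<in>hyperboloid \<rho>. u z = p z) \<and>
         (\<forall>(x, t)\<in>hyperboloid \<rho>. u (x, - t) = u (x, t)) \<and>
         (\<forall>m<n. \<forall>q\<in>polynomials_upto m. weighted_inner \<rho> w u q = 0)}"

definition w0 :: "real \<Rightarrow> real \<Rightarrow> real \<Rightarrow> real" where
  "w0 \<rho> \<gamma> t = \<bar>t\<bar> * (t\<^sup>2 - \<rho>\<^sup>2) powr (- 1 / 2) * (1 + \<rho>\<^sup>2 - t\<^sup>2) powr (\<gamma> - 1 / 2)"

definition in_coords ::
  "real \<Rightarrow> ((real^'d) \<times> real \<Rightarrow> real) \<Rightarrow> real^'d \<Rightarrow> real \<Rightarrow> real" where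
  "in_coords \<rho> u \<xi> t = u (sqrt (t\<^sup>2 - \<rho>\<^sup>2) *\<^sub>R \<xi>, t)"

text \<open>
  The derivative in \<open>t\<close> is taken within the range of \<open>t\<close> on the hyperboloid: it is the ordinary
  derivative when \<open>\<rho> < \<bar>t\<bar> < sqrt (\<rho>\<^sup>2 + 1)\<close> and the one-sided one at \<open>\<bar>t\<bar> = sqrt (\<rho>\<^sup>2 + 1)\<close>.
\<close>

definition D_t :: "real \<Rightarrow> (real \<Rightarrow> real) \<Rightarrow> real \<Rightarrow> real" where
  "D_t \<rho> g t = vector_derivative g (at t within {s. \<rho> < \<bar>s\<bar> \<and> \<bar>s\<bar> \<le> sqrt (\<rho>\<^sup>2 + 1)})"

definition laplacian :: "('a::euclidean_space \<Rightarrow> real) \<Rightarrow> 'a \<Rightarrow> real" where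
  "laplacian f x = (\<Sum>b\<in>Basis. (deriv ^^ 2) (\<lambda>s. f (x + s *\<^sub>R b)) 0)"

text \<open>
  The Laplace--Beltrami operator of the unit sphere is the angular part of the Euclidean Laplacian,
  \<open>\<Delta> = \<partial>\<^sub>r\<^sup>2 + (d - 1)/r \<partial>\<^sub>r + 1/r\<^sup>2 \<Delta>\<^sub>0\<close>; hence \<open>\<Delta>\<^sub>0 f\<close> is the restriction to the sphere of the
  Laplacian of the extension \<open>y \<mapsto> f (y / \<parallel>y\<parallel>)\<close>, which is constant in \<open>r\<close>.
\<close>

definition laplace_beltrami_sphere :: "(real^'d \<Rightarrow> real) \<Rightarrow> real^'d \<Rightarrow> real" where
  "laplace_beltrami_sphere f \<xi> = laplacian (\<lambda>y. f (sgn y)) \<xi>"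

end

theory Submission
  imports Defs
begin

text \<open>
  On the hyperboloid \<open>t\<^sup>2 = \<parallel>x\<parallel>\<^sup>2 + \<rho>\<^sup>2\<close>, so an element of the space, being even in \<open>t\<close>, is a polynomial \<open>P x\<close>
  of degree at most \<open>n\<close>. Substituting \<open>r = sqrt (t\<^sup>2 - \<rho>\<^sup>2)\<close> turns the inner product into that of
  the unit ball with weight \<open>(1 - \<parallel>x\<parallel>\<^sup>2) powr (\<gamma> - 1/2)\<close> and the operator into the classical
  \<open>D = \<Delta> - \<langle>x,\<nabla>\<rangle>\<^sup>2 - (2\<gamma> + d - 1)\<langle>x,\<nabla>\<rangle>\<close>. This \<open>D\<close> is symmetric for the inner product and acts on
  the homogeneous part of degree \<open>n\<close> as \<open>- n(n + 2\<gamma> + d - 1)\<close> modulo lower degrees, so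
  \<open>D P + n(n + 2\<gamma> + d - 1) P\<close> has degree below \<open>n\<close> and is orthogonal to all such polynomials,
  itself included.

  Symmetry is checked on homogeneous polynomials, where the integral splits into a moment of the
  radial weight and a sphere integral: the sphere part is Green's formula, which comes from the
  rotation invariance of the surface measure, and the radial part is a two-term recurrence
  obtained by integrating a total derivative.
\<close>

section \<open>Rotation invariance of the surface measure\<close>

text \<open>In the weight, \<open>|t|\<close> is the Jacobian in \<open>r dr = t dt\<close>, and
  \<open>(t^2 - \<rho>^2) powr (-1/2)\<close> removes one power of r from the surface factor
  \<open>r^(d-1)\<close>; what remains is the polar volume element \<open>r^(d-1) dr d\<xi>\<close>
  of the ball. The ball weight may blow up at the outer boundary, where integrating by parts in d
  variables would need limiting arguments. Homogeneity confines the singularity to one-dimensional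
  moments: there \<open>\<gamma> > -1/2\<close> gives both integrability and a vanishing boundary
  term, since the primitive carries the exponent \<open>\<gamma> + 1/2\<close>. In return, symmetry
  becomes a match of constants: Green's factor times one moment equals the eigenvalue difference
  times the next. Integrals yield vanishing almost everywhere only, while the equation is claimed at
  every point, including \<open>|t| = sqrt (\<rho>^2 + 1)\<close>. Continuity, the emptiness of open
  null sets and passage to the closure bridge this gap. As u is constrained only on the hyperboloid,
  all derivatives are taken of its homogeneous expansion there.\<close>

lemma nn_integral_lborel_translate:
  fixes c :: "'a::euclidean_space" and f :: "'a \<Rightarrow> ennreal"
  assumes [measurable]: "f \<in> borel_measurable borel"
  shows "(\<integral>\<^sup>+ x. f (c + x) \<partial>lborel) = (\<integral>\<^sup>+ x. f x \<partial>lborel)"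
  by (subst (2) lborel_distr_plus[of c, symmetric]) (simp add: nn_integral_distr)

text \<open>The uniqueness argument for Haar measure, run on the unit ball, which \<open>R\<close> preserves.
  The change of variables theorem of the library needs a well-ordered index type.\<close>

lemma nn_integral_lborel_orthogonal:
  fixes R :: "real^'d \<Rightarrow> real^'d" and g :: "real^'d \<Rightarrow> ennreal"
  assumes R: "orthogonal_transformation R" and g [measurable]: "g \<in> borel_measurable borel"
  shows "(\<integral>\<^sup>+ x. g (R x) \<partial>lborel) = (\<integral>\<^sup>+ x. g x \<partial>lborel)"
proof -
  define R' where "R' = inv R"
  have R': "orthogonal_transformation R'"
    unfolding R'_def by (rule orthogonal_transformation_inv[OF R])
  have RR': "R (R' y) = y" for y
    unfolding R'_def by (rule surj_f_inv_f[OF orthogonal_transformation_surj[OF R]])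
  note lin = orthogonal_transformation_linear[OF R] orthogonal_transformation_linear[OF R']
  have [measurable]: "R \<in> borel_measurable borel" "R' \<in> borel_measurable borel"
    using lin by (auto intro!: borel_measurable_continuous_onI linear_continuous_on
        simp: linear_conv_bounded_linear)
  let ?b = "indicator (cball 0 1) :: real^'d \<Rightarrow> ennreal"
  have [measurable, simp]: "?b \<in> borel_measurable borel"
    by (intro borel_measurable_indicator) auto
  \<comment> \<open>Here R enters as an isometry, beyond being linear and invertible.\<close>
  have bR: "?b (- R' y + x) = ?b (- R x + y)" for x y
  proof -
    have "norm (- R' y + x) = norm (R (- R' y + x))"
      using R by (simp add: orthogonal_transformation_norm)
    also have "R (- R' y + x) = R x - y"
      using lin by (simp add: linear_add linear_diff linear_neg RR')
    finally have "norm (- R' y + x) = norm (- R x + y)"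
      by (simp add: norm_minus_commute)
    then show ?thesis
      by (simp add: indicator_def)
  qed
  have "(\<integral>\<^sup>+ x. ?b x \<partial>lborel) * (\<integral>\<^sup>+ y. g y \<partial>lborel)
      = (\<integral>\<^sup>+ x. (\<integral>\<^sup>+ y. ?b x * g y \<partial>lborel) \<partial>lborel)"
    by (subst nn_integral_multc[symmetric]) (simp_all add: nn_integral_cmult)
  also have "\<dots> = (\<integral>\<^sup>+ x. (\<integral>\<^sup>+ y. ?b x * g (R x + y) \<partial>lborel) \<partial>lborel)"
    by (simp add: nn_integral_cmult nn_integral_lborel_translate)
  also have "\<dots> = (\<integral>\<^sup>+ y. (\<integral>\<^sup>+ x. ?b x * g (R x + y) \<partial>lborel) \<partial>lborel)"
    by (rule lborel_pair.Fubini'[symmetric]) measurable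
  \<comment> \<open>For fixed y the shift of x by \<open>- R' y\<close> turns \<open>R x + y\<close>
    into \<open>R x\<close>; g no longer sees y, and the y-integral falls on the indicator
    alone.\<close>
  also have "\<dots> = (\<integral>\<^sup>+ y. (\<integral>\<^sup>+ x. ?b (- R' y + x) * g (R x) \<partial>lborel) \<partial>lborel)"
  proof (rule nn_integral_cong)
    fix y
    have "R (- R' y + x) + y = R x" for x
      using lin by (simp add: linear_add linear_diff linear_neg RR')
    then show "(\<integral>\<^sup>+ x. ?b x * g (R x + y) \<partial>lborel) = (\<integral>\<^sup>+ x. ?b (- R' y + x) * g (R x) \<partial>lborel)"
      by (subst nn_integral_lborel_translate[of _ "- R' y", symmetric]) simp_all
  qed
  also have "\<dots> = (\<integral>\<^sup>+ x. (\<integral>\<^sup>+ y. ?b (- R' y + x) * g (R x) \<partial>lborel) \<partial>lborel)"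
    by (rule lborel_pair.Fubini') measurable
  also have "\<dots> = (\<integral>\<^sup>+ x. (\<integral>\<^sup>+ y. ?b (- R x + y) \<partial>lborel) * g (R x) \<partial>lborel)"
    unfolding bR by (simp add: nn_integral_multc)
  also have "\<dots> = (\<integral>\<^sup>+ x. (\<integral>\<^sup>+ y. ?b y \<partial>lborel) * g (R x) \<partial>lborel)"
    by (simp only: nn_integral_lborel_translate[of ?b] \<open>?b \<in> _\<close>)
  also have "\<dots> = (\<integral>\<^sup>+ y. ?b y \<partial>lborel) * (\<integral>\<^sup>+ x. g (R x) \<partial>lborel)"
    by (simp add: nn_integral_cmult)
  finally have eq: "emeasure lborel (cball 0 1 :: (real^'d) set) * (\<integral>\<^sup>+ x. g x \<partial>lborel)
      = emeasure lborel (cball 0 1 :: (real^'d) set) * (\<integral>\<^sup>+ x. g (R x) \<partial>lborel)"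
    by simp
  have "emeasure lborel (cball 0 1 :: (real^'d) set) \<noteq> 0"
    using content_cball_pos[of 1 "0::real^'d"] by (auto simp: measure_def enn2real_positive_iff)
  moreover have "emeasure lborel (cball 0 1 :: (real^'d) set) \<noteq> \<infinity>"
    using emeasure_bounded_finite[of "cball 0 1 :: (real^'d) set"] by simp
  ultimately show ?thesis
    using eq by (simp add: ennreal_mult_cancel_left)
qed

lemma distr_lborel_orthogonal:
  fixes R :: "real^'d \<Rightarrow> real^'d"
  assumes R: "orthogonal_transformation R"
  shows "distr lborel borel R = lborel"
proof (rule measure_eqI)
  fix A assume "A \<in> sets (distr lborel borel R)"
  then have [measurable]: "A \<in> sets borel" by simp
  have [measurable]: "R \<in> borel_measurable borel"
    using orthogonal_transformation_linear[OF R]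
    by (auto intro!: borel_measurable_continuous_onI linear_continuous_on
        simp: linear_conv_bounded_linear)
  have "emeasure (distr lborel borel R) A = (\<integral>\<^sup>+ x. indicator A (R x) \<partial>lborel)"
    using nn_integral_distr[of R lborel borel "indicator A"] by simp
  also have "\<dots> = emeasure lborel A"
    by (simp add: nn_integral_lborel_orthogonal[OF R])
  finally show "emeasure (distr lborel borel R) A = emeasure lborel A" .
qed simp

section \<open>The surface measure as an image of Lebesgue measure on the ball\<close>

lemma sets_sphere_measure [simp, measurable_cong]:
  "sets (sphere_measure :: (real^'d) measure) = sets (restrict_space borel (sphere 0 1))"
  by (simp add: sphere_measure_def)

lemma measurable_sgn_punctured_ball:
  "(sgn :: real^'d \<Rightarrow> real^'d) \<in>
     measurable (restrict_space lborel (cball 0 1 - {0})) (restrict_space borel (sphere 0 1))"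
proof (rule measurable_restrict_space2)
  show "sgn \<in> space (restrict_space lborel (cball 0 1 - {0})) \<rightarrow> sphere (0::real^'d) 1"
    by (auto simp: space_restrict_space norm_sgn)
  show "(sgn :: real^'d \<Rightarrow> real^'d) \<in> restrict_space lborel (cball 0 1 - {0}) \<rightarrow>\<^sub>M borel"
    by (rule measurable_restrict_space1) (simp add: sgn_div_norm[abs_def])
qed

lemma finite_sphere_measure: "finite_measure (sphere_measure :: (real^'d) measure)"
proof
  have "emeasure (distr (restrict_space lborel (cball 0 1 - {0})) (restrict_space borel (sphere 0 1)) sgn)
          (sphere (0::real^'d) 1)
      \<le> emeasure (restrict_space lborel (cball 0 1 - {0})) (space (restrict_space lborel (cball (0::real^'d) 1 - {0})))"
    by (subst emeasure_distr[OF measurable_sgn_punctured_ball])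
       (rule image_eqI[where x = "sphere 0 1"] emeasure_space | simp add: sets_restrict_space)+
  also have "\<dots> \<le> emeasure lborel (cball (0::real^'d) 1)"
    by (auto simp: space_restrict_space emeasure_restrict_space intro!: emeasure_mono)
  also have "\<dots> < \<infinity>" by (rule emeasure_bounded_finite) simp
  finally have "emeasure (distr (restrict_space lborel (cball 0 1 - {0})) (restrict_space borel (sphere 0 1)) sgn)
          (sphere (0::real^'d) 1) < \<infinity>" .
  then show "emeasure sphere_measure (space (sphere_measure :: (real^'d) measure)) \<noteq> \<infinity>"
    by (simp add: sphere_measure_def space_scale_measure space_restrict_space ennreal_mult_eq_top_iff less_top[symmetric])
qed

lemma space_sphere_measure [simp]: "space (sphere_measure :: (real^'d) measure) = sphere 0 1"
  by (simp add: sphere_measure_def space_scale_measure space_restrict_space)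

text \<open>Turns the factor d of \<open>sphere_measure\<close> into a density, a form in which it
  can be pulled out of integrals.\<close>

lemma scale_measure_eq_density: "scale_measure r M = density M (\<lambda>_. r)"
  by (rule measure_eqI) (simp_all add: emeasure_density nn_integral_cmult_indicator)

text \<open>Undoes the pushforward under \<open>sgn\<close>, so that rotation invariance and
  positivity on the sphere become questions about Lebesgue measure.\<close>

lemma sphere_integral:
  fixes f :: "real^'d \<Rightarrow> real"
  assumes [measurable]: "f \<in> borel_measurable borel"
  shows "(LINT \<xi>|sphere_measure. f \<xi>)
    = real CARD('d) * (LINT x:cball 0 1 - {0}|lborel. f (sgn x))"
proof -
  have [measurable]: "f \<in> borel_measurable (restrict_space borel (sphere 0 1))"
    by (rule measurable_restrict_space1) simp
  have "(LINT \<xi>|sphere_measure. f \<xi>) = (LINT \<xi>|density (distr (restrict_space lborel (cball 0 1 - {0}))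
      (restrict_space borel (sphere 0 1)) sgn) (\<lambda>_. ennreal (real CARD('d))). f \<xi>)"
    by (simp add: sphere_measure_def scale_measure_eq_density ennreal_of_nat_eq_real_of_nat)
  also have "\<dots> = (LINT \<xi>|distr (restrict_space lborel (cball 0 1 - {0}))
      (restrict_space borel (sphere 0 1)) sgn. real CARD('d) * f \<xi>)"
    by (subst integral_density) simp_all
  also have "\<dots> = real CARD('d) * (LINT x|restrict_space lborel (cball 0 1 - {0}). f (sgn x))"
    using measurable_sgn_punctured_ball by (subst integral_distr) simp_all
  also have "\<dots> = real CARD('d) * (LINT x:cball 0 1 - {0}|lborel. f (sgn x))"
    by (subst integral_restrict_space) (simp_all add: set_lebesgue_integral_def)
  finally show ?thesis .
qed

lemma sphere_integrable:
  fixes f :: "real^'d \<Rightarrow> real"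
  assumes f: "continuous_on UNIV f"
  shows "integrable sphere_measure f"
proof -
  interpret finite_measure "sphere_measure :: (real^'d) measure"
    by (rule finite_sphere_measure)
  have "compact (f ` sphere 0 1)"
    by (intro compact_continuous_image continuous_on_subset[OF f]) auto
  then obtain B where "\<And>x. x \<in> sphere 0 1 \<Longrightarrow> norm (f x) \<le> B"
    by (meson bounded_iff compact_imp_bounded imageI)
  then show ?thesis
    using f by (intro integrable_const_bound[where B = B] AE_I2)
      (auto intro!: measurable_restrict_space1 borel_measurable_continuous_onI
        simp: measurable_cong_sets[OF sets_sphere_measure refl])
qed

text \<open>An orthogonal map commutes with \<open>sgn\<close> and preserves the punctured ball, so
  the invariance of Lebesgue measure descends to the sphere.\<close>

lemma sphere_integral_orthogonal:
  fixes R :: "real^'d \<Rightarrow> real^'d" and f :: "real^'d \<Rightarrow> real"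
  assumes R: "orthogonal_transformation R" and f [measurable]: "f \<in> borel_measurable borel"
  shows "(LINT \<xi>|sphere_measure. f (R \<xi>)) = (LINT \<xi>|sphere_measure. f \<xi>)"
proof -
  have [measurable]: "R \<in> borel_measurable borel"
    using orthogonal_transformation_linear[OF R]
    by (auto intro!: borel_measurable_continuous_onI linear_continuous_on
        simp: linear_conv_bounded_linear)
  have [measurable]: "(sgn :: real^'d \<Rightarrow> real^'d) \<in> borel_measurable borel"
    by (simp add: sgn_div_norm[abs_def])
  have n: "norm (R x) = norm x" for x
    using R by (simp add: orthogonal_transformation_norm)
  have "R (sgn x) = sgn (R x)" for x
    using orthogonal_transformation_linear[OF R] by (simp add: sgn_div_norm linear_scale n)
  moreover have "(R x \<in> cball 0 1 - {0}) = (x \<in> cball 0 1 - {0})" for x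
  proof -
    have "R x = 0 \<longleftrightarrow> x = 0" by (metis n norm_eq_zero)
    then show ?thesis by (simp add: n)
  qed
  ultimately have "indicat_real (cball 0 1 - {0}) x *\<^sub>R f (R (sgn x))
      = indicat_real (cball 0 1 - {0}) (R x) * f (sgn (R x))" for x
    by (simp only: indicator_def real_scaleR_def)
  moreover have "(LINT \<xi>|sphere_measure. f (R \<xi>))
      = real CARD('d) * (LINT x:cball 0 1 - {0}|lborel. f (R (sgn x)))"
    by (rule sphere_integral) measurable
  ultimately have "(LINT \<xi>|sphere_measure. f (R \<xi>))
      = real CARD('d) * (LINT x|lborel. indicat_real (cball 0 1 - {0}) (R x) * f (sgn (R x)))"
    by (simp only: set_lebesgue_integral_def)
  also have "(LINT x|lborel. indicat_real (cball 0 1 - {0}) (R x) * f (sgn (R x)))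
      = (LINT x|distr lborel borel R. indicat_real (cball 0 1 - {0}) x * f (sgn x))"
  proof (rule integral_distr[symmetric])
    have [measurable]: "cball 0 1 - {0 :: real^'d} \<in> sets borel" by auto
    show "(\<lambda>x. indicat_real (cball 0 1 - {0}) x * f (sgn x)) \<in> borel_measurable borel"
      by measurable
  qed simp
  also have "\<dots> = (LINT x:cball 0 1 - {0}|lborel. f (sgn x))"
    by (simp add: distr_lborel_orthogonal[OF R] set_lebesgue_integral_def)
  finally show ?thesis by (simp add: sphere_integral)
qed

section \<open>Homogeneous polynomials\<close>

text \<open>Generating rules instead of coefficients make Leibniz' rule and Euler's identity plain
  inductions. Zero has every degree (\<open>hom_poly_zero\<close>), so families of homogeneous parts
  can be padded with zeros.\<close>

inductive hom_poly :: "nat \<Rightarrow> (real^'d \<Rightarrow> real) \<Rightarrow> bool" where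
  const: "hom_poly 0 (\<lambda>x. c)"
| coord: "hom_poly k f \<Longrightarrow> hom_poly (Suc k) (\<lambda>x. x $ i * f x)"
| add: "hom_poly k f \<Longrightarrow> hom_poly k g \<Longrightarrow> hom_poly k (\<lambda>x. f x + g x)"

lemma hom_poly_zero: "hom_poly k (\<lambda>x. 0)"
proof (induction k)
  case (Suc k)
  from hom_poly.coord[OF this, of undefined] show ?case by simp
qed (rule hom_poly.const)

lemma hom_poly_mult:
  assumes "hom_poly k f" "hom_poly l g"
  shows "hom_poly (k + l) (\<lambda>x. f x * g x)"
  using assms
proof induction
  case (const c)
  then show ?case
  proof (induction)
    case (coord k f i)
    from hom_poly.coord[OF coord.IH, of i] show ?case by (simp add: ac_simps)
  next
    case (add k f g)
    from hom_poly.add[OF add.IH] show ?case by (simp add: algebra_simps)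
  qed (simp add: hom_poly.const)
next
  case (coord k f i)
  from hom_poly.coord[OF coord.IH[OF coord.prems], of i] show ?case by (simp add: ac_simps)
next
  case (add k f h)
  from hom_poly.add[OF add.IH(1)[OF add.prems] add.IH(2)[OF add.prems]] show ?case
    by (simp add: algebra_simps)
qed

lemma hom_poly_cmult: "hom_poly k f \<Longrightarrow> hom_poly k (\<lambda>x. c * f x)"
  using hom_poly_mult[OF hom_poly.const, of k f c] by simp

lemma hom_poly_diff: "hom_poly k f \<Longrightarrow> hom_poly k g \<Longrightarrow> hom_poly k (\<lambda>x. f x - g x)"
  using hom_poly.add[of k f "\<lambda>x. (- 1) * g x"] hom_poly_cmult[of k g "- 1"] by simp

lemma hom_poly_sum:
  assumes "\<And>i. i \<in> I \<Longrightarrow> hom_poly k (f i)"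
  shows "hom_poly k (\<lambda>x. \<Sum>i\<in>I. f i x)"
  using assms
  by (induction I rule: infinite_finite_induct) (auto intro: hom_poly_zero hom_poly.add)

lemma hom_poly_coord: "hom_poly 1 (\<lambda>x. x $ i)"
  using hom_poly.coord[OF hom_poly.const, of i 1] by simp

lemma hom_poly_power: "hom_poly k f \<Longrightarrow> hom_poly (m * k) (\<lambda>x. f x ^ m)"
  by (induction m) (auto intro: hom_poly.const hom_poly_mult)

lemma hom_poly_prod:
  assumes "finite I" "\<And>i. i \<in> I \<Longrightarrow> hom_poly (k i) (f i)"
  shows "hom_poly (\<Sum>i\<in>I. k i) (\<lambda>x. \<Prod>i\<in>I. f i x)"
  using assms by (induction I rule: finite_induct) (auto intro: hom_poly.const hom_poly_mult)

lemma hom_poly_monomial: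
  "hom_poly (\<Sum>i\<in>UNIV. \<alpha> i) (\<lambda>x::real^'d. \<Prod>i\<in>UNIV. (x $ i) ^ \<alpha> i)"
proof (rule hom_poly_prod)
  show "hom_poly (\<alpha> i) (\<lambda>x::real^'d. (x $ i) ^ \<alpha> i)" for i
    using hom_poly_power[OF hom_poly_coord, of "\<alpha> i"] by simp
qed simp

lemma hom_poly_norm_power2: "hom_poly 2 (\<lambda>x::real^'d. (norm x)\<^sup>2)"
proof -
  have "(norm x)\<^sup>2 = (\<Sum>i\<in>UNIV. (x $ i)\<^sup>2)" for x :: "real^'d"
    by (simp add: norm_vec_def L2_set_def sum_nonneg)
  moreover have "hom_poly 2 (\<lambda>x::real^'d. \<Sum>i\<in>UNIV. (x $ i)\<^sup>2)"
  proof (rule hom_poly_sum)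
    show "hom_poly 2 (\<lambda>x::real^'d. (x $ i)\<^sup>2)" for i
      using hom_poly_power[OF hom_poly_coord, of 2] by simp
  qed
  ultimately show ?thesis by simp
qed

lemma hom_poly_scaleR: "hom_poly k f \<Longrightarrow> f (c *\<^sub>R x) = c ^ k * f x"
  by (induction rule: hom_poly.induct) (auto simp: algebra_simps)

text \<open>An operator depending on f alone, so that partial derivatives can be iterated without
  carrying the witness g of \<open>hom_poly_derivs\<close> along.\<close>

definition pderiv_at :: "'d \<Rightarrow> (real^'d \<Rightarrow> real) \<Rightarrow> real^'d \<Rightarrow> real" where
  "pderiv_at i f x = frechet_derivative f (at x) (axis i 1)"

text \<open>For constants the partial derivatives vanish, which matches the truncated subtraction \<open>0 - 1 = 0\<close>.\<close>

lemma hom_poly_derivs: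
  assumes "hom_poly k f"
  shows "\<exists>g. (\<forall>i. hom_poly (k - 1) (g i)) \<and> (k = 0 \<longrightarrow> (\<forall>i x. g i x = 0)) \<and>
    (\<forall>x. (f has_derivative (\<lambda>h. \<Sum>i\<in>UNIV. h $ i * g i x)) (at x)) \<and>
    (\<forall>x. (\<Sum>i\<in>UNIV. x $ i * g i x) = real k * f x)"
  using assms
proof induction
  case (const c)
  show ?case
    by (intro exI[of _ "\<lambda>_ _. 0"]) (auto intro: hom_poly_zero)
next
  case (coord k f i)
  then obtain g where g: "\<And>j. hom_poly (k - 1) (g j)" "k = 0 \<Longrightarrow> (\<forall>i x. g i x = 0)"
    "\<And>x. (f has_derivative (\<lambda>h. \<Sum>i\<in>UNIV. h $ i * g i x)) (at x)"
    "\<And>x. (\<Sum>i\<in>UNIV. x $ i * g i x) = real k * f x"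
    by blast
  let ?g = "\<lambda>j x. (if j = i then f x else 0) + x $ i * g j x"
  \<comment> \<open>For k = 0 the truncated degree k - 1 is 0, which would give the product degree
    1; only the vanishing of g gives degree 0.\<close>
  have "hom_poly k (\<lambda>x. x $ i * g j x)" for j
  proof (cases k)
    case 0
    then show ?thesis using g(2) by (simp add: hom_poly_zero)
  next
    case (Suc m)
    then show ?thesis using hom_poly.coord[OF g(1)] by simp
  qed
  then have 1: "hom_poly k (?g j)" for j
    using hom_poly.add[OF coord.hyps] by (cases "j = i") simp_all
  have 2: "(\<Sum>j\<in>UNIV. h $ j * ?g j x) = h $ i * f x + x $ i * (\<Sum>j\<in>UNIV. h $ j * g j x)" for h x
  proof -
    have "(\<Sum>j\<in>UNIV. h $ j * ?g j x)
        = (\<Sum>j\<in>UNIV. (if j = i then h $ j * f x else 0) + x $ i * (h $ j * g j x))"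
      by (intro sum.cong) (auto simp: algebra_simps)
    then show ?thesis by (simp add: sum.distrib sum_distrib_left)
  qed
  have 3: "((\<lambda>x. x $ i * f x) has_derivative (\<lambda>h. \<Sum>j\<in>UNIV. h $ j * ?g j x)) (at x)" for x
    unfolding 2 by (auto intro!: derivative_eq_intros g(3) bounded_linear_imp_has_derivative
        bounded_linear_vec_nth simp: algebra_simps)
  show ?case
    by (intro exI[of _ ?g]) (use 1 2 3 g(4) in \<open>auto simp: algebra_simps\<close>)
next
  case (add k f f')
  then obtain g g' where g: "\<And>j. hom_poly (k - 1) (g j)" "k = 0 \<Longrightarrow> (\<forall>i x. g i x = 0)"
    "\<And>x. (f has_derivative (\<lambda>h. \<Sum>i\<in>UNIV. h $ i * g i x)) (at x)"
    "\<And>x. (\<Sum>i\<in>UNIV. x $ i * g i x) = real k * f x"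
    and g': "\<And>j. hom_poly (k - 1) (g' j)" "k = 0 \<Longrightarrow> (\<forall>i x. g' i x = 0)"
    "\<And>x. (f' has_derivative (\<lambda>h. \<Sum>i\<in>UNIV. h $ i * g' i x)) (at x)"
    "\<And>x. (\<Sum>i\<in>UNIV. x $ i * g' i x) = real k * f' x"
    by blast
  have "((\<lambda>x. f x + f' x) has_derivative (\<lambda>h. \<Sum>i\<in>UNIV. h $ i * (g i x + g' i x))) (at x)" for x
    using has_derivative_add[OF g(3) g'(3)] by (simp add: algebra_simps sum.distrib)
  then show ?case
    by (intro exI[of _ "\<lambda>i x. g i x + g' i x"])
      (use g g' in \<open>auto simp: algebra_simps sum.distrib intro: hom_poly.add\<close>)
qed

lemma pderiv_at_eqI:
  assumes "(f has_derivative (\<lambda>h. \<Sum>i\<in>UNIV. h $ i * g i)) (at x)"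
  shows "pderiv_at i f x = g i"
proof -
  have "pderiv_at i f x = (\<Sum>j\<in>UNIV. axis i 1 $ j * g j)"
    by (simp add: pderiv_at_def frechet_derivative_at[OF assms, symmetric])
  also have "\<dots> = (\<Sum>j\<in>UNIV. if j = i then g j else 0)"
    by (intro sum.cong) (auto simp: axis_def)
  finally show ?thesis by simp
qed

lemma
  assumes f: "hom_poly k f"
  shows hom_poly_pderiv: "hom_poly (k - 1) (pderiv_at i f)"
    and hom_poly_0_pderiv: "k = 0 \<Longrightarrow> pderiv_at i f x = 0"
    and hom_poly_has_derivative: "(f has_derivative (\<lambda>h. \<Sum>i\<in>UNIV. h $ i * pderiv_at i f x)) (at x)"
    and hom_poly_euler: "(\<Sum>i\<in>UNIV. x $ i * pderiv_at i f x) = real k * f x"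
proof -
  obtain g where g: "\<And>j. hom_poly (k - 1) (g j)" "k = 0 \<Longrightarrow> (\<forall>i x. g i x = 0)"
    "\<And>x. (f has_derivative (\<lambda>h. \<Sum>i\<in>UNIV. h $ i * g i x)) (at x)"
    "\<And>x. (\<Sum>i\<in>UNIV. x $ i * g i x) = real k * f x"
    using hom_poly_derivs[OF f] by blast
  have "pderiv_at i f = g i" for i
    by (rule ext) (rule pderiv_at_eqI[OF g(3)])
  with g show "hom_poly (k - 1) (pderiv_at i f)" "k = 0 \<Longrightarrow> pderiv_at i f x = 0"
    "(f has_derivative (\<lambda>h. \<Sum>i\<in>UNIV. h $ i * pderiv_at i f x)) (at x)"
    "(\<Sum>i\<in>UNIV. x $ i * pderiv_at i f x) = real k * f x"
    by simp_all
qed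

lemma pderiv_at_mult:
  assumes f: "hom_poly k f" and g: "hom_poly l g"
  shows "pderiv_at i (\<lambda>x. f x * g x) x = pderiv_at i f x * g x + f x * pderiv_at i g x"
  by (rule pderiv_at_eqI, rule has_derivative_eq_rhs[OF has_derivative_mult[OF hom_poly_has_derivative[OF f]
      hom_poly_has_derivative[OF g]]])
    (auto simp: fun_eq_iff algebra_simps sum_distrib_left sum.distrib)

lemma pderiv_at_diff:
  assumes f: "hom_poly k f" and g: "hom_poly l g"
  shows "pderiv_at i (\<lambda>x. f x - g x) x = pderiv_at i f x - pderiv_at i g x"
  by (rule pderiv_at_eqI, rule has_derivative_eq_rhs[OF has_derivative_diff[OF hom_poly_has_derivative[OF f]
      hom_poly_has_derivative[OF g]]])
    (auto simp: fun_eq_iff algebra_simps sum_subtractf)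

lemma pderiv_at_coord: "pderiv_at i (\<lambda>x. x $ j) x = (if i = j then 1 else 0)"
  by (rule pderiv_at_eqI[where g = "\<lambda>i. if i = j then 1 else 0"])
    (simp add: if_distrib bounded_linear_imp_has_derivative bounded_linear_vec_nth cong: if_cong)

lemma hom_poly_continuous:
  assumes "hom_poly k f"
  shows "continuous_on UNIV f"
  using hom_poly_has_derivative[OF assms]
  by (meson continuous_at_imp_continuous_on has_derivative_continuous)

lemma hom_poly_bounded:
  assumes "hom_poly k f"
  obtains C where "\<And>x. x \<in> cball 0 1 \<Longrightarrow> \<bar>f x\<bar> \<le> C"
proof -
  have "compact (f ` cball 0 1)"
    by (intro compact_continuous_image continuous_on_subset[OF hom_poly_continuous[OF assms]]) auto
  then show ?thesis
    using that by (metis bounded_iff compact_imp_bounded imageI real_norm_def)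
qed

lemma hom_poly_sphere_integrable: "hom_poly k f \<Longrightarrow> integrable sphere_measure f"
  by (rule sphere_integrable[OF hom_poly_continuous])

text \<open>Built from \<open>pderiv_at\<close>, unlike \<open>laplacian\<close>, which uses
  one-dimensional \<open>deriv\<close>; the two meet in
  \<open>laplace_beltrami_sphere_hom_sum\<close>.\<close>

definition lap :: "(real^'d \<Rightarrow> real) \<Rightarrow> real^'d \<Rightarrow> real" where
  "lap f x = (\<Sum>i\<in>UNIV. pderiv_at i (pderiv_at i f) x)"

lemma hom_poly_lap: "hom_poly k f \<Longrightarrow> hom_poly (k - 2) (lap f)"
  unfolding lap_def[abs_def]
  using hom_poly_pderiv[OF hom_poly_pderiv, of k f]
  by (intro hom_poly_sum) (simp add: numeral_2_eq_2)

text \<open>Complements \<open>hom_poly_lap\<close>, where k - 2 is truncated for k below 2.\<close>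

lemma hom_poly_lap_eq_0: "hom_poly k f \<Longrightarrow> k < 2 \<Longrightarrow> lap f x = 0"
  unfolding lap_def
  using hom_poly_0_pderiv[OF hom_poly_pderiv, of k f] by (intro sum.neutral) auto

lemma lap_eq_0_of_zero: "(\<And>x. f x = 0) \<Longrightarrow> lap f x = 0"
proof -
  assume "\<And>x. f x = 0"
  then have "f = (\<lambda>x. 0)" by auto
  then show ?thesis using hom_poly_lap_eq_0[OF hom_poly_zero[of 0]] by simp
qed

section \<open>Green's formula on the sphere\<close>

definition rot :: "'d \<Rightarrow> 'd \<Rightarrow> real \<Rightarrow> real^'d \<Rightarrow> real^'d" where
  "rot i j \<theta> x = (\<chi> k. if k = i then cos \<theta> * x $ i - sin \<theta> * x $ j
     else if k = j then sin \<theta> * x $ i + cos \<theta> * x $ j else x $ k)"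

lemma orthogonal_transformation_rot:
  fixes i j :: "'d::finite"
  assumes "i \<noteq> j"
  shows "orthogonal_transformation (rot i j \<theta>)"
proof -
  have lin: "linear (rot i j \<theta>)"
    by (rule linearI) (auto simp: rot_def vec_eq_iff algebra_simps)
  have split: "(\<Sum>k\<in>UNIV. h k) = h i + h j + (\<Sum>k\<in>UNIV - {i, j}. h k)" for h :: "'d \<Rightarrow> real"
  proof -
    have "(\<Sum>k\<in>UNIV. h k) = (\<Sum>k\<in>{i, j}. h k) + (\<Sum>k\<in>UNIV - {i, j}. h k)"
      by (rule sum.subset_diff[of "{i, j}", THEN trans]) (auto simp: add.commute)
    with assms show ?thesis by simp
  qed
  have trig: "(cos \<theta> * a - sin \<theta> * b)\<^sup>2 + (sin \<theta> * a + cos \<theta> * b)\<^sup>2 = a\<^sup>2 + b\<^sup>2" for a b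
    using sin_cos_squared_add[of \<theta>] by algebra
  have "norm (rot i j \<theta> x) = norm x" for x
  proof -
    have "(\<Sum>k\<in>UNIV - {i, j}. (rot i j \<theta> x $ k)\<^sup>2) = (\<Sum>k\<in>UNIV - {i, j}. (x $ k)\<^sup>2)"
      by (intro sum.cong) (auto simp: rot_def)
    then have "(\<Sum>k\<in>UNIV. (rot i j \<theta> x $ k)\<^sup>2) = (\<Sum>k\<in>UNIV. (x $ k)\<^sup>2)"
      using assms trig[of "x $ i" "x $ j"] by (simp add: split) (simp add: rot_def)
    then show ?thesis by (simp add: norm_vec_def L2_set_def)
  qed
  with lin show ?thesis by (simp add: orthogonal_transformation)
qed

text \<open>Rotations of one plane form a one-parameter group: at every angle the velocity of the
  orbit is the same linear field \<open>y_i e_j - y_j e_i\<close>, taken at the current point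
  y.\<close>

lemma rot_has_derivative:
  fixes i j :: "'d::finite" and f :: "real^'d \<Rightarrow> real"
  assumes f: "hom_poly k f" and "i \<noteq> j"
  shows "((\<lambda>\<theta>. f (rot i j \<theta> x)) has_real_derivative
    (rot i j \<theta> x $ i * pderiv_at j f (rot i j \<theta> x) - rot i j \<theta> x $ j * pderiv_at i f (rot i j \<theta> x)))
    (at \<theta>)"
proof -
  let ?y = "rot i j \<theta> x"
  let ?v = "?y $ i *\<^sub>R axis j 1 - ?y $ j *\<^sub>R axis i 1 :: real^'d"
  have "((\<lambda>\<theta>. rot i j \<theta> x $ k) has_real_derivative ?v $ k) (at \<theta>)" for k
    using assms(2)
    by (cases "k = i"; cases "k = j")
      (auto simp: rot_def axis_def intro!: derivative_eq_intros)
  then have "((\<lambda>\<theta>. rot i j \<theta> x $ k) has_derivative (\<lambda>h. h * ?v $ k)) (at \<theta>)" for k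
    unfolding has_field_derivative_def by (simp only: mult.commute[of _ "?v $ k"])
  then have "((\<lambda>\<theta>. rot i j \<theta> x) has_derivative (\<lambda>h. h *\<^sub>R ?v)) (at \<theta>)"
    unfolding has_derivative_componentwise_within[where f = "\<lambda>\<theta>. rot i j \<theta> x"]
    by (auto simp: Basis_vec_def cart_eq_inner_axis[symmetric] inner_axis)
  from has_derivative_compose[OF this hom_poly_has_derivative[OF f]]
  have "((\<lambda>\<theta>. f (rot i j \<theta> x)) has_derivative
      (\<lambda>h. \<Sum>k\<in>UNIV. (h *\<^sub>R ?v) $ k * pderiv_at k f ?y)) (at \<theta>)" .
  moreover have "(\<Sum>k\<in>UNIV. (h *\<^sub>R ?v) $ k * pderiv_at k f ?y)
      = (?y $ i * pderiv_at j f ?y - ?y $ j * pderiv_at i f ?y) * h" for h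
  proof -
    have "(\<Sum>k\<in>UNIV. (h *\<^sub>R ?v) $ k * pderiv_at k f ?y)
       = (\<Sum>k\<in>UNIV. (if k = j then h * ?y $ i * pderiv_at j f ?y else 0)
          - (if k = i then h * ?y $ j * pderiv_at i f ?y else 0))"
      by (intro sum.cong) (auto simp: axis_def algebra_simps)
    then show ?thesis by (simp add: sum_subtractf algebra_simps)
  qed
  ultimately show ?thesis by (simp add: has_field_derivative_def)
qed

text \<open>The integral of \<open>f (rot i j \<theta> \<xi>)\<close> does not depend on \<theta>,
  and this is its derivative at 0. Limit and integral are exchanged along the steps
  \<open>1 / (n + 1)\<close>: each difference quotient integrates to zero, and dominated convergence
  applies.\<close>

lemma sphere_integral_rotation_field:
  fixes i j :: "'d::finite" and f :: "real^'d \<Rightarrow> real"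
  assumes f: "hom_poly k f" and ij: "i \<noteq> j"
  shows "(LINT \<xi>|sphere_measure. \<xi> $ i * pderiv_at j f \<xi> - \<xi> $ j * pderiv_at i f \<xi>) = 0"
proof -
  define D where "D x = x $ i * pderiv_at j f x - x $ j * pderiv_at i f x" for x
  define s where "s n x = (f (rot i j (1 / real (Suc n)) x) - f x) * real (Suc n)" for n x
  have hD: "hom_poly (Suc (k - 1)) D"
    unfolding D_def[abs_def] by (intro hom_poly_diff hom_poly.coord hom_poly_pderiv f)
  obtain C where C: "\<And>x. x \<in> cball 0 1 \<Longrightarrow> \<bar>D x\<bar> \<le> C"
    using hom_poly_bounded[OF hD] by blast
  have der: "((\<lambda>\<theta>. f (rot i j \<theta> x)) has_real_derivative D (rot i j \<theta> x)) (at \<theta>)" for x \<theta>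
    unfolding D_def by (rule rot_has_derivative[OF f ij])
  have rot0: "rot i j 0 x = x" for x
    by (auto simp: rot_def vec_eq_iff)
  have fR: "continuous_on UNIV (\<lambda>x. f (rot i j \<theta> x))" for \<theta>
    using orthogonal_transformation_linear[OF orthogonal_transformation_rot[OF ij]]
    by (intro continuous_on_compose2[OF hom_poly_continuous[OF f]] linear_continuous_on)
      (auto simp: linear_conv_bounded_linear)
  have si: "integrable sphere_measure (s n)" for n
    unfolding s_def[abs_def]
    by (intro Bochner_Integration.integrable_mult_left Bochner_Integration.integrable_diff sphere_integrable fR hom_poly_continuous[OF f])
  have zero: "(LINT \<xi>|sphere_measure. s n \<xi>) = 0" for n
  proof -
    have "(LINT \<xi>|sphere_measure. f (rot i j (1 / real (Suc n)) \<xi>)) = (LINT \<xi>|sphere_measure. f \<xi>)"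
      by (intro sphere_integral_orthogonal orthogonal_transformation_rot ij
          borel_measurable_continuous_onI hom_poly_continuous[OF f])
    then show ?thesis
      unfolding s_def
      by (simp add: Bochner_Integration.integral_diff sphere_integrable fR hom_poly_continuous[OF f] del: of_nat_Suc)
  qed
  interpret finite_measure "sphere_measure :: (real^'d) measure"
    by (rule finite_sphere_measure)
  have "(\<lambda>n. LINT \<xi>|sphere_measure. s n \<xi>) \<longlonglongrightarrow> (LINT \<xi>|sphere_measure. D \<xi>)"
  proof (rule integral_dominated_convergence[where w = "\<lambda>_. C"])
    show "D \<in> borel_measurable sphere_measure" "s n \<in> borel_measurable sphere_measure" for n
      using hom_poly_sphere_integrable[OF hD] si[of n] by auto
    show "AE x in sphere_measure. (\<lambda>n. s n x) \<longlonglongrightarrow> D x"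
    proof (rule AE_I2)
      fix x
      have "((\<lambda>\<theta>. (f (rot i j \<theta> x) - f x) / \<theta>) \<longlongrightarrow> D x) (at 0)"
        using der[of x 0] by (simp add: has_field_derivative_iff rot0)
      moreover have "filterlim (\<lambda>n. 1 / real (Suc n)) (at 0) sequentially"
        unfolding filterlim_at using lim_1_over_n[THEN LIMSEQ_Suc] by simp
      ultimately show "(\<lambda>n. s n x) \<longlonglongrightarrow> D x"
        unfolding s_def by (auto dest: filterlim_compose simp del: of_nat_Suc)
    qed
    \<comment> \<open>By the mean value theorem the quotient is D at another point of the orbit,
      which stays on the sphere; hence one bound C serves all n.\<close>
    show "AE x in sphere_measure. norm (s n x) \<le> C" for n
    proof (rule AE_I2)
      fix x :: "real^'d" assume "x \<in> space sphere_measure"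
      then have x: "norm x = 1" by simp
      define \<delta> where "\<delta> = 1 / real (Suc n)"
      have "\<delta> > 0" by (simp add: \<delta>_def)
      then obtain z where "f (rot i j \<delta> x) - f (rot i j 0 x) = (\<delta> - 0) * D (rot i j z x)"
        using MVT2[of 0 \<delta> "\<lambda>\<theta>. f (rot i j \<theta> x)", OF _ der] by blast
      then have "s n x = D (rot i j z x)"
        using \<open>\<delta> > 0\<close> by (simp add: s_def rot0 \<delta>_def[symmetric] divide_simps) (simp add: \<delta>_def)
      moreover have "norm (rot i j z x) = 1"
        using x orthogonal_transformation_rot[OF ij, of z] by (simp add: orthogonal_transformation_norm)
      ultimately show "norm (s n x) \<le> C"
        using C[of "rot i j z x"] by simp
    qed
  qed simp
  then show ?thesis
    unfolding zero D_def[symmetric] by (simp add: LIMSEQ_const_iff)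
qed

lemma sphere_integral_cong:
  "(\<And>x. norm x = 1 \<Longrightarrow> f x = g x) \<Longrightarrow> (LINT \<xi>|sphere_measure. f \<xi>) = (LINT \<xi>|sphere_measure. g \<xi>)"
  for f g :: "real^'d \<Rightarrow> real"
  by (rule Bochner_Integration.integral_cong) auto

text \<open>Summing the rotation identity for the fields \<open>x\<^sub>j \<partial>\<^sub>i - x\<^sub>i \<partial>\<^sub>j\<close> applied to \<open>x\<^sub>j f\<close> over all \<open>j\<close>
  and using Euler's identity.\<close>

lemma sphere_integral_pderiv:
  fixes f :: "real^'d \<Rightarrow> real"
  assumes f: "hom_poly k f"
  shows "(LINT \<xi>|sphere_measure. pderiv_at i f \<xi>)
    = (real k + real CARD('d) - 1) * (LINT \<xi>|sphere_measure. \<xi> $ i * f \<xi>)"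
proof -
  let ?D = "\<lambda>j x. x $ j * pderiv_at i (\<lambda>x. x $ j * f x) x - x $ i * pderiv_at j (\<lambda>x. x $ j * f x) x"
  note int = hom_poly_sphere_integrable
  have hj: "hom_poly (Suc k) (\<lambda>x. x $ j * f x)" for j
    by (rule hom_poly.coord[OF f])
  have hD: "hom_poly (Suc k) (?D j)" for j
    using hom_poly_pderiv[OF hj] by (auto intro!: hom_poly_diff hom_poly.coord)
  have "(LINT \<xi>|sphere_measure. ?D j \<xi>) = 0" for j
    using sphere_integral_rotation_field[OF hj, of j i j] by (cases "j = i") simp_all
  then have "0 = (\<Sum>j\<in>UNIV. (LINT \<xi>|sphere_measure. ?D j \<xi>))" by simp
  also have "\<dots> = (LINT \<xi>|sphere_measure. (\<Sum>j\<in>UNIV. ?D j \<xi>))"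
    by (rule Bochner_Integration.integral_sum[symmetric]) (rule int[OF hD])
  also have "\<dots> = (LINT \<xi>|sphere_measure. pderiv_at i f \<xi> - (real k + real CARD('d) - 1) * (\<xi> $ i * f \<xi>))"
  proof (rule sphere_integral_cong)
    fix x :: "real^'d" assume x: "norm x = 1"
    have p: "pderiv_at l (\<lambda>x. x $ j * f x) x = (if l = j then f x else 0) + x $ j * pderiv_at l f x" for l j
      using pderiv_at_mult[OF hom_poly_coord f, of l j x] by (simp add: pderiv_at_coord)
    have "(\<Sum>j\<in>UNIV. ?D j x) = (\<Sum>j\<in>UNIV. (if j = i then x $ i * f x else 0)
        + (x $ j)\<^sup>2 * pderiv_at i f x - x $ i * f x - x $ i * (x $ j * pderiv_at j f x))"
      unfolding p by (intro sum.cong) (auto simp: algebra_simps power2_eq_square)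
    \<comment> \<open>The constant k + d - 1 is made up of k from Euler's identity, d from the
      repeated term \<open>x $ i * f x\<close>, and -1 from the diagonal j = i.\<close>
    also have "\<dots> = x $ i * f x + (\<Sum>j\<in>UNIV. (x $ j)\<^sup>2) * pderiv_at i f x
        - real CARD('d) * (x $ i * f x) - x $ i * (real k * f x)"
      by (simp add: sum.distrib sum_subtractf sum_distrib_left[symmetric] sum_distrib_right[symmetric]
          hom_poly_euler[OF f])
    also have "(\<Sum>j\<in>UNIV. (x $ j)\<^sup>2) = 1"
      using x by (simp add: norm_vec_def L2_set_def)
    finally show "(\<Sum>j\<in>UNIV. ?D j x) = pderiv_at i f x - (real k + real CARD('d) - 1) * (x $ i * f x)"
      by (simp add: algebra_simps)
  qed
  also have "\<dots> = (LINT \<xi>|sphere_measure. pderiv_at i f \<xi>)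
      - (real k + real CARD('d) - 1) * (LINT \<xi>|sphere_measure. \<xi> $ i * f \<xi>)"
    by (simp add: int[OF hom_poly_pderiv[OF f]] int[OF hom_poly.coord[OF f]])
  finally show ?thesis by simp
qed

text \<open>\<open>sphere_integral_pderiv\<close> is applied to the field
  \<open>g grad f - f grad g\<close> of degree k + l - 1: its divergence is
  \<open>lap f * g - f * lap g\<close>, and by Euler its radial component is
  \<open>(k - l) * f * g\<close>. Hence the constant \<open>(k + l - 1) + d - 1\<close>.\<close>

lemma sphere_green:
  fixes f g :: "real^'d \<Rightarrow> real"
  assumes f: "hom_poly k f" and g: "hom_poly l g"
  shows "(LINT \<xi>|sphere_measure. lap f \<xi> * g \<xi>) - (LINT \<xi>|sphere_measure. f \<xi> * lap g \<xi>)
    = (real k + real l + real CARD('d) - 2) * (real k - real l) * (LINT \<xi>|sphere_measure. f \<xi> * g \<xi>)"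
proof -
  note int = hom_poly_sphere_integrable
  note mult = hom_poly_mult
  let ?v = "\<lambda>i x. pderiv_at i f x * g x - f x * pderiv_at i g x"
  have hv: "hom_poly (k + l - 1) (?v i)" for i
  proof -
    have "hom_poly (k + l - 1) (\<lambda>x. pderiv_at i f x * g x)"
      using mult[OF hom_poly_pderiv[OF f] g, of i] hom_poly_0_pderiv[OF f]
      by (cases k) (simp_all add: hom_poly_zero)
    moreover have "hom_poly (k + l - 1) (\<lambda>x. f x * pderiv_at i g x)"
      using mult[OF f hom_poly_pderiv[OF g], of i] hom_poly_0_pderiv[OF g]
      by (cases l) (simp_all add: hom_poly_zero)
    ultimately show ?thesis by (rule hom_poly_diff)
  qed
  have pv: "pderiv_at i (?v i) x = pderiv_at i (pderiv_at i f) x * g x - f x * pderiv_at i (pderiv_at i g) x" for i x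
    using pderiv_at_diff[OF mult[OF hom_poly_pderiv[OF f] g] mult[OF f hom_poly_pderiv[OF g]], of i i i x]
      pderiv_at_mult[OF hom_poly_pderiv[OF f] g, of i i x] pderiv_at_mult[OF f hom_poly_pderiv[OF g], of i i x]
    by simp
  have "(LINT \<xi>|sphere_measure. lap f \<xi> * g \<xi>) - (LINT \<xi>|sphere_measure. f \<xi> * lap g \<xi>)
    = (LINT \<xi>|sphere_measure. lap f \<xi> * g \<xi> - f \<xi> * lap g \<xi>)"
    by (simp add: int[OF mult[OF hom_poly_lap[OF f] g]] int[OF mult[OF f hom_poly_lap[OF g]]])
  also have "\<dots> = (LINT \<xi>|sphere_measure. (\<Sum>i\<in>UNIV. pderiv_at i (?v i) \<xi>))"
    unfolding pv lap_def by (simp add: sum_subtractf sum_distrib_left sum_distrib_right)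
  also have "\<dots> = (\<Sum>i\<in>UNIV. (LINT \<xi>|sphere_measure. pderiv_at i (?v i) \<xi>))"
    by (rule Bochner_Integration.integral_sum) (rule int[OF hom_poly_pderiv[OF hv]])
  also have "\<dots> = (\<Sum>i\<in>UNIV. (real (k + l - 1) + real CARD('d) - 1) * (LINT \<xi>|sphere_measure. \<xi> $ i * ?v i \<xi>))"
    by (simp only: sphere_integral_pderiv[OF hv])
  also have "\<dots> = (real (k + l - 1) + real CARD('d) - 1) * (LINT \<xi>|sphere_measure. (\<Sum>i\<in>UNIV. \<xi> $ i * ?v i \<xi>))"
    using Bochner_Integration.integral_sum[of UNIV sphere_measure "\<lambda>i \<xi>. \<xi> $ i * ?v i \<xi>", OF int[OF hom_poly.coord[OF hv]]]
    by (simp add: sum_distrib_left)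
  also have "(\<lambda>\<xi>. \<Sum>i\<in>UNIV. \<xi> $ i * ?v i \<xi>) = (\<lambda>\<xi>. (real k - real l) * (f \<xi> * g \<xi>))"
  proof
    fix x :: "real^'d"
    have "(\<Sum>i\<in>UNIV. x $ i * ?v i x)
      = (\<Sum>i\<in>UNIV. x $ i * pderiv_at i f x) * g x - f x * (\<Sum>i\<in>UNIV. x $ i * pderiv_at i g x)"
      by (simp add: sum_subtractf sum_distrib_left sum_distrib_right algebra_simps)
    then show "(\<Sum>i\<in>UNIV. x $ i * ?v i x) = (real k - real l) * (f x * g x)"
      by (simp add: hom_poly_euler[OF f] hom_poly_euler[OF g] algebra_simps)
  qed
  \<comment> \<open>For k = l = 0 the truncated k + l - 1 is 0 instead of -1, but then the factor k
    - l vanishes.\<close>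
  also have "(real (k + l - 1) + real CARD('d) - 1) * (LINT \<xi>|sphere_measure. (real k - real l) * (f \<xi> * g \<xi>))
    = (real k + real l + real CARD('d) - 2) * (real k - real l) * (LINT \<xi>|sphere_measure. f \<xi> * g \<xi>)"
    unfolding Bochner_Integration.integral_mult_right_zero
    by (cases "k = 0 \<and> l = 0") (auto simp: of_nat_diff algebra_simps)
  finally show ?thesis .
qed

section \<open>Radial moments\<close>

lemma open_AE_lborel_empty:
  fixes U :: "'a::euclidean_space set"
  assumes U: "open U" and AE: "AE x in lborel. x \<notin> U"
  shows "U = {}"
proof (rule ccontr)
  assume "U \<noteq> {}"
  have "U \<in> null_sets lborel"
    using AE U by (subst AE_iff_null_sets) auto
  then have "negligible U"
    by (simp add: negligible_iff_null_sets null_sets_completionI)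
  with open_not_negligible[OF U \<open>U \<noteq> {}\<close>] show False by simp
qed

text \<open>The extension \<open>f (sgn x)\<close> is nonnegative with integral zero, hence zero
  almost everywhere on the ball. It is continuous off the origin, so the set where it is nonzero
  inside the ball is open and null, thus empty.\<close>

lemma sphere_integral_eq_0D:
  fixes f :: "real^'d \<Rightarrow> real"
  assumes f: "continuous_on UNIV f" and nonneg: "\<And>x. 0 \<le> f x"
    and zero: "(LINT \<xi>|sphere_measure. f \<xi>) = 0" and \<xi>: "norm \<xi> = 1"
  shows "f \<xi> = 0"
proof -
  have [measurable]: "f \<in> borel_measurable borel" "(sgn :: real^'d \<Rightarrow> real^'d) \<in> borel_measurable borel"
    using f by (auto simp: sgn_div_norm[abs_def] intro: borel_measurable_continuous_onI)
  have [measurable]: "cball 0 1 - {0 :: real^'d} \<in> sets borel" by auto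
  have "compact (f ` cball 0 1)"
    by (intro compact_continuous_image continuous_on_subset[OF f]) auto
  then obtain B where B: "\<And>x. x \<in> cball 0 1 \<Longrightarrow> norm (f x) \<le> B"
    by (meson bounded_iff compact_imp_bounded imageI)
  have B': "norm (f (sgn x)) \<le> \<bar>B\<bar>" if "x \<noteq> 0" for x
    using B[of "sgn x"] that by (simp add: norm_sgn)
  have "set_integrable lborel (cball 0 1 - {0 :: real^'d}) (\<lambda>x. B)"
    unfolding set_integrable_def
    using emeasure_bounded_finite[OF bounded_subset[OF bounded_cball Diff_subset], of "0 :: real^'d" 1 "{0}"]
    by (intro integrable_scaleR_left integrable_real_indicator) auto
  then have int: "set_integrable lborel (cball 0 1 - {0}) (\<lambda>x. f (sgn x))"
    by (rule set_integrable_bound)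
      (use B' in \<open>auto simp: set_borel_measurable_def\<close>)
  have "(LINT x:cball 0 1 - {0}|lborel. f (sgn x)) = 0"
    using zero by (subst (asm) sphere_integral) simp_all
  then have "AE x in lborel. indicat_real (cball 0 1 - {0}) x *\<^sub>R f (sgn x) = 0"
    using int nonneg unfolding set_lebesgue_integral_def set_integrable_def
    by (subst (asm) integral_nonneg_eq_0_iff_AE) auto
  define U where "U = {x \<in> ball 0 1 - {0}. f (sgn x) \<noteq> 0}"
  have "open (ball 0 1 - {0 :: real^'d})" by (simp add: open_delete)
  moreover have "continuous_on (ball 0 1 - {0 :: real^'d}) (\<lambda>x. f (sgn x))"
    by (rule continuous_on_compose2[OF f]) (auto intro!: continuous_intros)
  ultimately have "open ((ball 0 1 - {0}) \<inter> (\<lambda>x. f (sgn x)) -` (- {0}))"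
    by (intro continuous_open_preimage) auto
  also have "(ball 0 1 - {0}) \<inter> (\<lambda>x. f (sgn x)) -` (- {0}) = U"
    by (auto simp: U_def)
  finally have "open U" .
  moreover have "AE x in lborel. x \<notin> U"
    using \<open>AE x in lborel. _ x = 0\<close> by eventually_elim (auto simp: U_def indicator_def)
  ultimately have "U = {}" by (rule open_AE_lborel_empty)
  \<comment> \<open>A point of direction \<xi> inside the open ball, to which U was restricted in
    order to be open.\<close>
  have "sgn ((1 / 2) *\<^sub>R \<xi>) = \<xi>" "(1 / 2) *\<^sub>R \<xi> \<in> ball 0 1 - {0}"
    using \<xi> by (auto simp: sgn_div_norm)
  with \<open>U = {}\<close> show ?thesis unfolding U_def by (metis (mono_tags, lifting) empty_iff mem_Collect_eq)
qed

text \<open>With \<open>r = sqrt (t^2 - \<rho>^2)\<close> and \<open>r dr = t dt\<close> this is the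
  density \<open>r^(a+1) (1 - r^2) powr (\<gamma> - 1/2) dr\<close> on 0 < r < 1, so
  \<open>radial_moment\<close> is half the Beta function at \<open>a/2 + 1\<close> and
  \<open>\<gamma> + 1/2\<close>.\<close>

definition radial_weight :: "real \<Rightarrow> real \<Rightarrow> nat \<Rightarrow> real \<Rightarrow> real" where
  "radial_weight \<rho> \<gamma> a t = sqrt (t\<^sup>2 - \<rho>\<^sup>2) ^ a * (t * (1 + \<rho>\<^sup>2 - t\<^sup>2) powr (\<gamma> - 1 / 2))"

definition radial_moment :: "real \<Rightarrow> real \<Rightarrow> nat \<Rightarrow> real" where
  "radial_moment \<rho> \<gamma> a = (LINT t:{\<rho><..<sqrt (\<rho>\<^sup>2 + 1)}|lborel. radial_weight \<rho> \<gamma> a t)"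

context
  fixes \<rho> \<gamma> :: real
  assumes \<rho>: "\<rho> > 0" and \<gamma>: "\<gamma> > - 1 / 2"
begin

lemma rho_less: "\<rho> < sqrt (\<rho>\<^sup>2 + 1)"
  using \<rho> by (intro real_less_rsqrt) simp

lemma radial_bounds:
  assumes "\<rho> < t" "t < sqrt (\<rho>\<^sup>2 + 1)"
  shows "0 < t\<^sup>2 - \<rho>\<^sup>2" "t\<^sup>2 - \<rho>\<^sup>2 < 1"
proof -
  show "0 < t\<^sup>2 - \<rho>\<^sup>2" using assms(1) \<rho> by (simp add: power_strict_mono)
  have "t\<^sup>2 < (sqrt (\<rho>\<^sup>2 + 1))\<^sup>2" using assms \<rho> by (intro power_strict_mono) auto
  also have "\<dots> = \<rho>\<^sup>2 + 1" by (simp add: add_nonneg_nonneg)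
  finally show "t\<^sup>2 - \<rho>\<^sup>2 < 1" by simp
qed

lemma radial_bounds_le:
  assumes "\<rho> \<le> \<bar>t\<bar>" "\<bar>t\<bar> \<le> sqrt (\<rho>\<^sup>2 + 1)"
  shows "0 \<le> t\<^sup>2 - \<rho>\<^sup>2" "t\<^sup>2 - \<rho>\<^sup>2 \<le> 1"
proof -
  show "0 \<le> t\<^sup>2 - \<rho>\<^sup>2" using power_mono[OF assms(1), of 2] \<rho> by simp
  have "t\<^sup>2 \<le> (sqrt (\<rho>\<^sup>2 + 1))\<^sup>2" using power_mono[OF assms(2), of 2] by simp
  also have "\<dots> = \<rho>\<^sup>2 + 1" by (simp add: add_nonneg_nonneg)
  finally show "t\<^sup>2 - \<rho>\<^sup>2 \<le> 1" by simp
qed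

lemma isCont_radial_weight:
  assumes "\<rho> < t" "t < sqrt (\<rho>\<^sup>2 + 1)"
  shows "isCont (radial_weight \<rho> \<gamma> a) t"
  unfolding radial_weight_def[abs_def] using radial_bounds[OF assms]
  by (intro continuous_intros) auto

text \<open>The base reaches 0 at the outer end, but \<open>\<gamma> > -1/2\<close> makes the
  exponent positive, so \<open>powr\<close> stays continuous there.\<close>

lemma continuous_on_weight_primitive:
  "continuous_on {\<rho>..sqrt (\<rho>\<^sup>2 + 1)} (\<lambda>t. (1 + \<rho>\<^sup>2 - t\<^sup>2) powr (\<gamma> + 1 / 2))"
proof (intro continuous_on_powr' continuous_intros ballI conjI impI)
  fix t assume "t \<in> {\<rho>..sqrt (\<rho>\<^sup>2 + 1)}"
  then show "0 \<le> 1 + \<rho>\<^sup>2 - t\<^sup>2" using radial_bounds_le(2)[of t] \<rho> by simp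
qed (use \<gamma> in simp)

lemma weight_primitive_has_derivative:
  assumes "\<rho> < t" "t < sqrt (\<rho>\<^sup>2 + 1)"
  shows "((\<lambda>t. (1 + \<rho>\<^sup>2 - t\<^sup>2) powr (\<gamma> + 1 / 2)) has_real_derivative
    - ((2 * \<gamma> + 1) * (t * (1 + \<rho>\<^sup>2 - t\<^sup>2) powr (\<gamma> - 1 / 2)))) (at t)"
  using radial_bounds[OF assms]
  by (auto intro!: derivative_eq_intros simp: field_simps)

text \<open>For \<open>\<gamma> < 1/2\<close> the weight is unbounded at the outer end. For a = 0 it
  is nonnegative with an explicit primitive that is continuous up to both ends, which gives
  integrability; since r < 1, this case dominates all others.\<close>

lemma set_integrable_radial_weight:
  "set_integrable lborel {\<rho><..<sqrt (\<rho>\<^sup>2 + 1)} (radial_weight \<rho> \<gamma> a)"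
proof -
  let ?b = "sqrt (\<rho>\<^sup>2 + 1)"
  let ?F = "\<lambda>t. - ((1 + \<rho>\<^sup>2 - t\<^sup>2) powr (\<gamma> + 1 / 2)) / (2 * \<gamma> + 1)"
  have F: "continuous_on {\<rho>..?b} ?F"
    using \<gamma> by (intro continuous_intros continuous_on_weight_primitive) auto
  have "set_integrable lborel (einterval (ereal \<rho>) (ereal ?b)) (radial_weight \<rho> \<gamma> 0)"
  proof (rule interval_integral_FTC_nonneg(1))
    show "DERIV ?F x :> radial_weight \<rho> \<gamma> 0 x" if "ereal \<rho> < ereal x" "ereal x < ereal ?b" for x
      unfolding radial_weight_def
      by (rule DERIV_cong[OF DERIV_cdivide[OF DERIV_minus[OF weight_primitive_has_derivative]]])
        (use that \<gamma> in auto)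
    show "AE x in lborel. ereal \<rho> < ereal x \<longrightarrow> ereal x < ereal ?b \<longrightarrow> 0 \<le> radial_weight \<rho> \<gamma> 0 x"
      using \<rho> by (intro AE_I2) (auto simp: radial_weight_def)
    show "((?F \<circ> real_of_ereal) \<longlongrightarrow> ?F \<rho>) (at_right (ereal \<rho>))"
      "((?F \<circ> real_of_ereal) \<longlongrightarrow> ?F ?b) (at_left (ereal ?b))"
      unfolding ereal_tendsto_simps
      using continuous_on_Icc_at_rightD[OF F rho_less] continuous_on_Icc_at_leftD[OF F rho_less] .
  qed (use rho_less isCont_radial_weight in auto)
  then have "set_integrable lborel {\<rho><..<?b} (radial_weight \<rho> \<gamma> 0)"
    by simp
  then show ?thesis
  proof (rule set_integrable_bound)
    show "set_borel_measurable lborel {\<rho><..<?b} (radial_weight \<rho> \<gamma> a)"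
      unfolding set_borel_measurable_def radial_weight_def by measurable
    show "AE x in lborel. x \<in> {\<rho><..<?b} \<longrightarrow> norm (radial_weight \<rho> \<gamma> a x) \<le> norm (radial_weight \<rho> \<gamma> 0 x)"
    proof (intro AE_I2 impI)
      fix x assume "x \<in> {\<rho><..<?b}"
      then have "0 < x\<^sup>2 - \<rho>\<^sup>2" "x\<^sup>2 - \<rho>\<^sup>2 < 1" using radial_bounds by auto
      then have "\<bar>sqrt (x\<^sup>2 - \<rho>\<^sup>2) ^ a\<bar> \<le> 1"
        by (simp add: power_abs power_le_one)
      then show "norm (radial_weight \<rho> \<gamma> a x) \<le> norm (radial_weight \<rho> \<gamma> 0 x)"
        unfolding radial_weight_def norm_mult by (intro mult_right_mono) auto
    qed
  qed
qed

text \<open>The function integrated is the derivative of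
  \<open>r^(a+2) (1 - r^2) powr (\<gamma> + 1/2)\<close>, which vanishes at r = 0 and at r = 1. The
  constant a + 2\<gamma> + 3 is the sum of a + 2, from the power of r, and 2\<gamma> + 1, from the
  weight.\<close>

lemma radial_moment_recurrence:
  "(real a + 2) * radial_moment \<rho> \<gamma> a = (real a + 2 * \<gamma> + 3) * radial_moment \<rho> \<gamma> (a + 2)"
proof -
  let ?b = "sqrt (\<rho>\<^sup>2 + 1)"
  let ?h = "radial_weight \<rho> \<gamma>"
  let ?F = "\<lambda>t. sqrt (t\<^sup>2 - \<rho>\<^sup>2) ^ (a + 2) * (1 + \<rho>\<^sup>2 - t\<^sup>2) powr (\<gamma> + 1 / 2)"
  let ?f = "\<lambda>t. (real a + 2) * ?h a t - (real a + 2 * \<gamma> + 3) * ?h (a + 2) t"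
  have int: "set_integrable lborel {\<rho><..<?b} (\<lambda>t. c * ?h k t)" for c k
    using set_integrable_radial_weight by (rule set_integrable_mult_right)
  have F: "continuous_on {\<rho>..?b} ?F"
    by (intro continuous_intros continuous_on_weight_primitive)
  have "(LBINT t=ereal \<rho>..ereal ?b. ?f t) = ?F ?b - ?F \<rho>"
  proof (rule interval_integral_FTC_integrable)
    fix x assume "ereal \<rho> < ereal x" "ereal x < ereal ?b"
    then have x: "\<rho> < x" "x < ?b" by auto
    note pos = radial_bounds[OF x]
    then have r: "sqrt (x\<^sup>2 - \<rho>\<^sup>2) > 0" by simp
    have "(1 + \<rho>\<^sup>2 - x\<^sup>2) powr (\<gamma> + 1 / 2) = (1 + \<rho>\<^sup>2 - x\<^sup>2) * (1 + \<rho>\<^sup>2 - x\<^sup>2) powr (\<gamma> - 1 / 2)"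
      using powr_add[of "1 + \<rho>\<^sup>2 - x\<^sup>2" 1 "\<gamma> - 1 / 2"] pos by (simp add: add.commute)
    moreover have "1 + \<rho>\<^sup>2 - x\<^sup>2 = 1 - (sqrt (x\<^sup>2 - \<rho>\<^sup>2))\<^sup>2"
      using pos by simp
    ultimately have s: "(1 + \<rho>\<^sup>2 - x\<^sup>2) powr (\<gamma> + 1 / 2)
        = (1 - (sqrt (x\<^sup>2 - \<rho>\<^sup>2))\<^sup>2) * (1 + \<rho>\<^sup>2 - x\<^sup>2) powr (\<gamma> - 1 / 2)"
      by (simp only:)
    have "((\<lambda>t. sqrt (t\<^sup>2 - \<rho>\<^sup>2)) has_real_derivative x / sqrt (x\<^sup>2 - \<rho>\<^sup>2)) (at x)"
      using pos by (auto intro!: derivative_eq_intros simp: field_simps)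
    from DERIV_mult[OF DERIV_power[OF this, of "a + 2"] weight_primitive_has_derivative[OF x]]
    have "(?F has_real_derivative ?f x) (at x)"
    proof (rule DERIV_cong)
      define r where "r = sqrt (x\<^sup>2 - \<rho>\<^sup>2)"
      define p where "p = (1 + \<rho>\<^sup>2 - x\<^sup>2) powr (\<gamma> - 1 / 2)"
      have "r > 0" using r by (simp add: r_def)
      then show "real (a + 2) * (x / sqrt (x\<^sup>2 - \<rho>\<^sup>2) * sqrt (x\<^sup>2 - \<rho>\<^sup>2) ^ (a + 2 - Suc 0)) * (1 + \<rho>\<^sup>2 - x\<^sup>2) powr (\<gamma> + 1 / 2) +
          - ((2 * \<gamma> + 1) * (x * (1 + \<rho>\<^sup>2 - x\<^sup>2) powr (\<gamma> - 1 / 2))) * sqrt (x\<^sup>2 - \<rho>\<^sup>2) ^ (a + 2) = ?f x"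
        unfolding s radial_weight_def r_def[symmetric] p_def[symmetric]
        by (simp add: field_simps power2_eq_square)
    qed
    then show "(?F has_vector_derivative ?f x) (at x)"
      by (simp add: has_real_derivative_iff_has_vector_derivative)
    show "isCont ?f x"
      using isCont_radial_weight[OF x] by (intro continuous_intros)
  next
    show "((?F \<circ> real_of_ereal) \<longlongrightarrow> ?F \<rho>) (at_right (ereal \<rho>))"
      "((?F \<circ> real_of_ereal) \<longlongrightarrow> ?F ?b) (at_left (ereal ?b))"
      unfolding ereal_tendsto_simps
      using continuous_on_Icc_at_rightD[OF F rho_less] continuous_on_Icc_at_leftD[OF F rho_less] .
    show "set_integrable lborel (einterval (ereal \<rho>) (ereal ?b)) ?f"
      using int by (auto intro: set_integral_diff)
  qed (use rho_less in auto)
  also have "\<dots> = 0" by (simp add: add_nonneg_nonneg)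
  also have "(LBINT t=ereal \<rho>..ereal ?b. ?f t) = (LINT t:{\<rho><..<?b}|lborel. ?f t)"
    using rho_less by (subst interval_integral_Ioo) auto
  also have "\<dots> = (real a + 2) * radial_moment \<rho> \<gamma> a - (real a + 2 * \<gamma> + 3) * radial_moment \<rho> \<gamma> (a + 2)"
    unfolding radial_moment_def by (subst set_integral_diff(2)) (auto intro: int set_integrable_radial_weight)
  finally show ?thesis by simp
qed

text \<open>The two sheets contribute equally, and the boundary points form a null set.\<close>

lemma even_integral_double_interval:
  fixes g :: "real \<Rightarrow> real"
  assumes int: "set_integrable lborel {\<rho><..<sqrt (\<rho>\<^sup>2 + 1)} g" and even: "\<And>t. g (- t) = g t"
    and g [measurable]: "g \<in> borel_measurable borel"
  shows "(LINT t:{t. \<rho> \<le> \<bar>t\<bar> \<and> \<bar>t\<bar> \<le> sqrt (\<rho>\<^sup>2 + 1)}|lborel. g t)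
    = 2 * (LINT t:{\<rho><..<sqrt (\<rho>\<^sup>2 + 1)}|lborel. g t)"
proof -
  let ?b = "sqrt (\<rho>\<^sup>2 + 1)"
  let ?J = "{\<rho><..<?b}"
  let ?k = "\<lambda>t. indicat_real ?J t * g t"
  have k: "integrable lborel ?k"
    using int by (simp add: set_integrable_def)
  then have k': "integrable lborel (\<lambda>t. ?k (- t))"
    using lborel_integrable_real_affine[of ?k "- 1" 0] by simp
  have [measurable]: "{t. \<rho> \<le> \<bar>t\<bar> \<and> \<bar>t\<bar> \<le> ?b} \<in> sets borel" by measurable
  have "(LINT t:{t. \<rho> \<le> \<bar>t\<bar> \<and> \<bar>t\<bar> \<le> ?b}|lborel. g t) = (LINT t|lborel. ?k t + ?k (- t))"
    unfolding set_lebesgue_integral_def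
  proof (rule integral_cong_AE)
    show "AE t in lborel. indicat_real {t. \<rho> \<le> \<bar>t\<bar> \<and> \<bar>t\<bar> \<le> ?b} t *\<^sub>R g t = ?k t + ?k (- t)"
      using AE_lborel_singleton[of \<rho>] AE_lborel_singleton[of "- \<rho>"]
        AE_lborel_singleton[of ?b] AE_lborel_singleton[of "- ?b"]
    proof eventually_elim
      case (elim t)
      then show ?case
        using \<rho> by (cases "t > 0") (auto simp: indicator_def even abs_if)
    qed
  qed measurable
  also have "\<dots> = (LINT t|lborel. ?k t) + (LINT t|lborel. ?k (- t))"
    by (rule Bochner_Integration.integral_add[OF k k'])
  also have "(LINT t|lborel. ?k (- t)) = (LINT t|lborel. ?k t)"
    using lborel_integral_real_affine[of "- 1" ?k 0] by simp
  finally show ?thesis by (simp add: set_lebesgue_integral_def)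
qed

text \<open>At radius r a homogeneous part is \<open>r^deg\<close> times its value at \<xi>, so each
  term splits into a radial and a spherical factor. The assumption is on the product u q over the
  hyperboloid, where alone u is known; the 2 counts the sheets.\<close>

lemma weighted_inner_eq_moments:
  fixes u q :: "(real^'d) \<times> real \<Rightarrow> real" and F :: "'k \<Rightarrow> real^'d \<Rightarrow> real"
  assumes d: "CARD('d) \<ge> 2" and F: "\<And>k. k \<in> K \<Longrightarrow> hom_poly (deg k) (F k)"
    and uq: "\<And>x t. (x, t) \<in> hyperboloid \<rho> \<Longrightarrow> u (x, t) * q (x, t) = (\<Sum>k\<in>K. F k x)"
  shows "weighted_inner \<rho> (w0 \<rho> \<gamma>) u q
    = 2 * (\<Sum>k\<in>K. radial_moment \<rho> \<gamma> (deg k + CARD('d) - 2) * (LINT \<xi>|sphere_measure. F k \<xi>))"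
proof -
  let ?b = "sqrt (\<rho>\<^sup>2 + 1)"
  let ?S = "\<lambda>k. LINT \<xi>|sphere_measure. F k \<xi>"
  let ?r = "\<lambda>t. sqrt (t\<^sup>2 - \<rho>\<^sup>2)"
  let ?c = "\<lambda>t. (t\<^sup>2 - \<rho>\<^sup>2) powr ((real CARD('d) - 1) / 2)"
  let ?E = "\<lambda>t. ?c t * ((\<Sum>k\<in>K. ?r t ^ deg k * ?S k) * w0 \<rho> \<gamma> t)"
  have "weighted_inner \<rho> (w0 \<rho> \<gamma>) u q = (LINT t:{t. \<rho> \<le> \<bar>t\<bar> \<and> \<bar>t\<bar> \<le> ?b}|lborel. ?E t)"
    unfolding weighted_inner_def hyperboloid_integral_def
  proof (rule set_lebesgue_integral_cong)
    show "{t. \<rho> \<le> \<bar>t\<bar> \<and> \<bar>t\<bar> \<le> ?b} \<in> sets lborel" by simp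
    show "\<forall>t. t \<in> {t. \<rho> \<le> \<bar>t\<bar> \<and> \<bar>t\<bar> \<le> ?b} \<longrightarrow>
        ?c t * (LINT \<xi>|sphere_measure. (case (?r t *\<^sub>R \<xi>, t) of (x, t) \<Rightarrow> u (x, t) * q (x, t) * w0 \<rho> \<gamma> t)) = ?E t"
    proof (intro allI impI)
      fix t assume "t \<in> {t. \<rho> \<le> \<bar>t\<bar> \<and> \<bar>t\<bar> \<le> ?b}"
      then have t: "\<rho> \<le> \<bar>t\<bar>" "\<bar>t\<bar> \<le> ?b" by auto
      have "(LINT \<xi>|sphere_measure. u (?r t *\<^sub>R \<xi>, t) * q (?r t *\<^sub>R \<xi>, t) * w0 \<rho> \<gamma> t)
        = (LINT \<xi>|sphere_measure. (\<Sum>k\<in>K. ?r t ^ deg k * F k \<xi>) * w0 \<rho> \<gamma> t)"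
      proof (rule sphere_integral_cong)
        fix \<xi> :: "real^'d" assume "norm \<xi> = 1"
        then have "(?r t *\<^sub>R \<xi>, t) \<in> hyperboloid \<rho>"
          using t radial_bounds_le[OF t] by (simp add: hyperboloid_def power_mult_distrib)
        from uq[OF this] show "u (?r t *\<^sub>R \<xi>, t) * q (?r t *\<^sub>R \<xi>, t) * w0 \<rho> \<gamma> t
            = (\<Sum>k\<in>K. ?r t ^ deg k * F k \<xi>) * w0 \<rho> \<gamma> t"
          by (simp add: hom_poly_scaleR[OF F])
      qed
      also have "\<dots> = (\<Sum>k\<in>K. ?r t ^ deg k * ?S k) * w0 \<rho> \<gamma> t"
        using hom_poly_sphere_integrable[OF F] by (simp add: Bochner_Integration.integral_sum)
      finally show "?c t * (LINT \<xi>|sphere_measure. (case (?r t *\<^sub>R \<xi>, t) of (x, t) \<Rightarrow> u (x, t) * q (x, t) * w0 \<rho> \<gamma> t)) = ?E t"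
        by simp
    qed
  qed
  also have "\<dots> = 2 * (LINT t:{\<rho><..<?b}|lborel. ?E t)"
    and "(LINT t:{\<rho><..<?b}|lborel. ?E t) = (\<Sum>k\<in>K. radial_moment \<rho> \<gamma> (deg k + CARD('d) - 2) * ?S k)"
  proof -
    let ?G = "\<lambda>t. \<Sum>k\<in>K. radial_weight \<rho> \<gamma> (deg k + CARD('d) - 2) t * ?S k"
    have EG: "?E t = ?G t" if "t \<in> {\<rho><..<?b}" for t
    proof -
      have pos: "0 < t\<^sup>2 - \<rho>\<^sup>2" and t: "t > 0" using that radial_bounds[of t] \<rho> by auto
      \<comment> \<open>Surface factor and weight combine to \<open>r^(d-1) / r = r^(d-2)\<close>, a
        natural power as d is at least 2; hence the shift d - 2 in the moment indices.\<close>
      have "?c t * (t\<^sup>2 - \<rho>\<^sup>2) powr (- 1 / 2) = (t\<^sup>2 - \<rho>\<^sup>2) powr ((real CARD('d) - 1) / 2 + (- 1 / 2))"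
        by (rule powr_add[symmetric])
      also have "(real CARD('d) - 1) / 2 + (- 1 / 2) = real (CARD('d) - 2) * (1 / 2)"
        using d by (simp add: of_nat_diff field_simps)
      also have "(t\<^sup>2 - \<rho>\<^sup>2) powr (real (CARD('d) - 2) * (1 / 2)) = ?r t ^ (CARD('d) - 2)"
        using pos by (simp add: powr_half_sqrt[symmetric] powr_realpow[symmetric] powr_powr mult.commute)
      finally have "?c t * w0 \<rho> \<gamma> t = ?r t ^ (CARD('d) - 2) * (t * (1 + \<rho>\<^sup>2 - t\<^sup>2) powr (\<gamma> - 1 / 2))"
        using t by (simp add: w0_def)
      then have "?E t = ?r t ^ (CARD('d) - 2) * (t * (1 + \<rho>\<^sup>2 - t\<^sup>2) powr (\<gamma> - 1 / 2)) * (\<Sum>k\<in>K. ?r t ^ deg k * ?S k)"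
        by (simp add: mult.assoc mult.left_commute mult.commute)
      also have "\<dots> = ?G t"
        unfolding sum_distrib_left
      proof (rule sum.cong)
        fix k
        have "deg k + CARD('d) - 2 = deg k + (CARD('d) - 2)" using d by simp
        then show "?r t ^ (CARD('d) - 2) * (t * (1 + \<rho>\<^sup>2 - t\<^sup>2) powr (\<gamma> - 1 / 2)) * (?r t ^ deg k * ?S k)
            = radial_weight \<rho> \<gamma> (deg k + CARD('d) - 2) t * ?S k"
          by (simp add: radial_weight_def power_add)
      qed simp
      finally show ?thesis .
    qed
    have int: "set_integrable lborel {\<rho><..<?b} (\<lambda>t. radial_weight \<rho> \<gamma> a t * c)" for a c
      by (intro set_integrable_mult_left set_integrable_radial_weight)
    have "set_integrable lborel {\<rho><..<?b} ?G"
      using int unfolding set_integrable_def by (simp add: sum_distrib_left)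
    then have "set_integrable lborel {\<rho><..<?b} ?E"
      using EG by (subst set_integrable_cong[OF refl refl]) auto
    moreover have "w0 \<rho> \<gamma> \<in> borel_measurable borel"
      unfolding w0_def[abs_def] by measurable
    ultimately show "(LINT t:{t. \<rho> \<le> \<bar>t\<bar> \<and> \<bar>t\<bar> \<le> ?b}|lborel. ?E t) = 2 * (LINT t:{\<rho><..<?b}|lborel. ?E t)"
      by (intro even_integral_double_interval) (auto simp: w0_def)
    have "(LINT t:{\<rho><..<?b}|lborel. ?E t) = (LINT t:{\<rho><..<?b}|lborel. ?G t)"
      using EG by (intro set_lebesgue_integral_cong) auto
    also have "\<dots> = (\<Sum>k\<in>K. LINT t:{\<rho><..<?b}|lborel. radial_weight \<rho> \<gamma> (deg k + CARD('d) - 2) t * ?S k)"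
      using int unfolding set_integrable_def set_lebesgue_integral_def scaleR_sum_right
      by (intro Bochner_Integration.integral_sum) auto
    finally show "(LINT t:{\<rho><..<?b}|lborel. ?E t) = (\<Sum>k\<in>K. radial_moment \<rho> \<gamma> (deg k + CARD('d) - 2) * ?S k)"
      by (simp add: radial_moment_def)
  qed
  ultimately show ?thesis by simp
qed

end

section \<open>Orthogonality on the ball\<close>

lemma
  fixes f :: "'i \<Rightarrow> 'a \<Rightarrow> 'b::{banach, second_countable_topology}"
  assumes "\<And>i. i \<in> I \<Longrightarrow> set_integrable M A (f i)"
  shows set_integrable_sum: "set_integrable M A (\<lambda>x. \<Sum>i\<in>I. f i x)"
    and set_integral_sum: "(LINT x:A|M. (\<Sum>i\<in>I. f i x)) = (\<Sum>i\<in>I. (LINT x:A|M. f i x))"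
  using assms unfolding set_integrable_def set_lebesgue_integral_def scaleR_sum_right
  by (auto intro: Bochner_Integration.integrable_sum Bochner_Integration.integral_sum)

text \<open>The Euler operator multiplies degree k by k, so the first and second powers of it in D
  contribute minus this number; the Laplacian part only lowers the degree.\<close>

definition ball_eigenvalue :: "real \<Rightarrow> nat \<Rightarrow> nat \<Rightarrow> real" where
  "ball_eigenvalue \<gamma> d k = real k * (real k + 2 * \<gamma> + real d - 1)"

text \<open>The homogeneous part of degree \<open>j\<close> of \<open>D P + n(n + 2\<gamma> + d - 1) P\<close> for \<open>P = (\<Sum>k. H k)\<close>.\<close>

definition residual :: "real \<Rightarrow> nat \<Rightarrow> (nat \<Rightarrow> real^'d \<Rightarrow> real) \<Rightarrow> nat \<Rightarrow> real^'d \<Rightarrow> real" where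
  "residual \<gamma> n H j x = lap (H (j + 2)) x
    + (ball_eigenvalue \<gamma> CARD('d) n - ball_eigenvalue \<gamma> CARD('d) j) * H j x"

lemma hom_poly_residual:
  assumes "\<And>k. hom_poly k (H k)"
  shows "hom_poly j (residual \<gamma> n H j)"
  unfolding residual_def[abs_def]
  using hom_poly_lap[OF assms, of "j + 2"] by (intro hom_poly.add hom_poly_cmult assms) simp

context
  fixes \<rho> \<gamma> :: real
  assumes \<rho>: "\<rho> > 0" and \<gamma>: "\<gamma> > - 1 / 2"
begin

text \<open>This is the symmetry of D for a pair of homogeneous polynomials, with the Euler terms
  collected on the right. Green's constant \<open>(k - l) (k + l + d - 2)\<close> meets
  \<open>M (k + l - 2)\<close>, and the moment recurrence converts the product into the eigenvalue
  difference times \<open>M (k + l)\<close>.\<close>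

lemma ball_green:
  fixes f g :: "real^'d \<Rightarrow> real"
  assumes d: "CARD('d) \<ge> 2" and f: "hom_poly k f" and g: "hom_poly l g"
  defines "M \<equiv> \<lambda>m. radial_moment \<rho> \<gamma> (m + CARD('d) - 2)"
  shows "M (k + l - 2) * (LINT \<xi>|sphere_measure. lap f \<xi> * g \<xi>)
    = M (k + l - 2) * (LINT \<xi>|sphere_measure. f \<xi> * lap g \<xi>)
      + (ball_eigenvalue \<gamma> CARD('d) k - ball_eigenvalue \<gamma> CARD('d) l) * (M (k + l) * (LINT \<xi>|sphere_measure. f \<xi> * g \<xi>))"
proof -
  let ?S = "LINT \<xi>|sphere_measure. f \<xi> * g \<xi>"
  have eig: "ball_eigenvalue \<gamma> CARD('d) k - ball_eigenvalue \<gamma> CARD('d) l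
      = (real k - real l) * (real k + real l + 2 * \<gamma> + real CARD('d) - 1)"
    by (simp add: ball_eigenvalue_def algebra_simps)
  show ?thesis
  proof (cases "k + l \<ge> 2")
    case True
    define a where "a = k + l - 2 + CARD('d) - 2"
    have a: "k + l + CARD('d) - 2 = a + 2" "real a = real k + real l + real CARD('d) - 4"
    proof -
      obtain e where e: "CARD('d) = e + 2" using d by (metis add.commute le_Suc_ex)
      obtain m where m: "k + l = m + 2" using True by (metis add.commute le_Suc_ex)
      show "k + l + CARD('d) - 2 = a + 2" by (simp add: a_def e m)
      show "real a = real k + real l + real CARD('d) - 4"
      proof -
        have "real k + real l = real m + 2" using m by linarith
        moreover have "a = m + e" by (simp add: a_def e m)
        ultimately show ?thesis by (simp add: e)
      qed
    qed
    have "(real k + real l + real CARD('d) - 2) * M (k + l - 2)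
        = (real k + real l + 2 * \<gamma> + real CARD('d) - 1) * M (k + l)"
    proof -
      have "M (k + l - 2) = radial_moment \<rho> \<gamma> a" "M (k + l) = radial_moment \<rho> \<gamma> (a + 2)"
        by (simp_all only: M_def a(1) a_def[symmetric])
      moreover have "real k + real l + real CARD('d) - 2 = real a + 2"
        "real k + real l + 2 * \<gamma> + real CARD('d) - 1 = real a + 2 * \<gamma> + 3"
        using a(2) by simp_all
      ultimately show ?thesis
        by (simp only: radial_moment_recurrence[OF \<rho> \<gamma>])
    qed
    note M = this
    let ?X = "LINT \<xi>|sphere_measure. lap f \<xi> * g \<xi>" and ?Y = "LINT \<xi>|sphere_measure. f \<xi> * lap g \<xi>"
    have "M (k + l - 2) * ?X - M (k + l - 2) * ?Y = M (k + l - 2) * (?X - ?Y)"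
      by (simp only: right_diff_distrib)
    also have "\<dots> = (real k + real l + real CARD('d) - 2) * M (k + l - 2) * ((real k - real l) * ?S)"
      unfolding sphere_green[OF f g] by (simp only: ac_simps)
    also have "\<dots> = (ball_eigenvalue \<gamma> CARD('d) k - ball_eigenvalue \<gamma> CARD('d) l) * (M (k + l) * ?S)"
      unfolding M eig by (simp only: ac_simps)
    finally show ?thesis by simp
  next
    \<comment> \<open>Here k + l - 2 is truncated, but both Laplacians vanish. For degrees 0 and 1,
      Green's formula with constant of modulus d - 1 > 0 makes the integral of f g zero.\<close>
    case False
    then have "lap f x = 0" "lap g x = 0" for x
      using hom_poly_lap_eq_0[OF f] hom_poly_lap_eq_0[OF g] by auto
    moreover have "k = l \<or> ?S = 0"
      using sphere_green[OF f g] False d by (auto simp: calculation)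
    ultimately show ?thesis by auto
  qed
qed

section \<open>Vanishing of the residual\<close>

context
  fixes n :: nat and H :: "nat \<Rightarrow> real^'d \<Rightarrow> real"
  assumes d: "CARD('d) \<ge> 2" and H: "\<And>k. hom_poly k (H k)" and H0: "\<And>k x. k > n \<Longrightarrow> H k x = 0"
    and ortho: "\<And>l q. l < n \<Longrightarrow> hom_poly l q \<Longrightarrow>
      (\<Sum>k\<le>n. radial_moment \<rho> \<gamma> (k + l + CARD('d) - 2) * (LINT \<xi>|sphere_measure. H k \<xi> * q \<xi>)) = 0"
begin

text \<open>In degree n the two eigenvalues coincide, and beyond n all parts of H are zero; this is
  what lowers the degree.\<close>

lemma residual_top: "j \<ge> n \<Longrightarrow> residual \<gamma> n H j x = 0"
  unfolding residual_def using lap_eq_0_of_zero[of "H (j + 2)"] H0[of "j + 2"] H0[of j] by (cases "j = n") auto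

text \<open>Symmetry moves the operator to q, producing \<open>lap q\<close> of degree l - 2 and a
  multiple of q. Both have degree below n, so both are orthogonal to the sum of the H k.\<close>

lemma residual_ortho:
  assumes l: "l < n" and q: "hom_poly l q"
  shows "(\<Sum>j\<le>n. radial_moment \<rho> \<gamma> (j + l + CARD('d) - 2)
    * (LINT \<xi>|sphere_measure. residual \<gamma> n H j \<xi> * q \<xi>)) = 0"
proof -
  let ?M = "\<lambda>m. radial_moment \<rho> \<gamma> (m + CARD('d) - 2)"
  let ?ev = "ball_eigenvalue \<gamma> CARD('d)"
  let ?S = "\<lambda>f g. LINT \<xi>|sphere_measure. f \<xi> * g \<xi>"
  let ?L = "\<lambda>k. ?M (k + l - 2) * ?S (lap (H k)) q"
  note int = hom_poly_sphere_integrable[OF hom_poly_mult]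
  have L0: "?L k = 0" if "k < 2 \<or> k > n" for k
    using that hom_poly_lap_eq_0[OF H, of k] lap_eq_0_of_zero[of "H k"] H0[of k] by auto
  \<comment> \<open>The residual is indexed by the degree after applying \<open>lap\<close>, Green's
    formula by the degree before; the terms at the ends of the shift vanish by
    \<open>L0\<close>.\<close>
  have "(\<Sum>j\<le>n. ?L (j + 2)) = (\<Sum>k\<le>n. ?L k)"
  proof -
    have "(\<Sum>j\<le>n. ?L (j + 2)) = (\<Sum>k\<in>{2..n + 2}. ?L k)"
      by (rule sum.reindex_bij_witness[of _ "\<lambda>k. k - 2" "\<lambda>j. j + 2"]) auto
    also have "\<dots> = (\<Sum>k\<le>n + 2. ?L k)"
    proof (rule sum.mono_neutral_left)
      show "\<forall>k\<in>{..n + 2} - {2..n + 2}. ?L k = 0"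
        by (intro ballI L0) auto
    qed auto
    also have "\<dots> = (\<Sum>k\<le>n. ?L k)"
    proof (rule sum.mono_neutral_right)
      show "\<forall>k\<in>{..n + 2} - {..n}. ?L k = 0"
        by (intro ballI L0) auto
    qed auto
    finally show ?thesis .
  qed
  also have "\<dots> = (\<Sum>k\<le>n. ?M (k + l - 2) * ?S (H k) (lap q)) + (\<Sum>k\<le>n. (?ev k - ?ev l) * (?M (k + l) * ?S (H k) q))"
    using ball_green[OF d H q] by (simp add: sum.distrib)
  \<comment> \<open>For l >= 2 the index k + l - 2 is k + (l - 2), as orthogonality to
    \<open>lap q\<close> requires; for smaller l, \<open>lap q\<close> is zero.\<close>
  also have "(\<Sum>k\<le>n. ?M (k + l - 2) * ?S (H k) (lap q)) = 0"
  proof (cases "l < 2")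
    case True
    then show ?thesis using hom_poly_lap_eq_0[OF q] by simp
  next
    case False
    then show ?thesis using ortho[OF _ hom_poly_lap[OF q]] l by simp
  qed
  finally have A: "(\<Sum>j\<le>n. ?L (j + 2)) = (\<Sum>k\<le>n. (?ev k - ?ev l) * (?M (k + l) * ?S (H k) q))"
    by simp
  have "?M (j + l) * ?S (residual \<gamma> n H j) q = ?L (j + 2) + (?ev n - ?ev j) * (?M (j + l) * ?S (H j) q)" for j
  proof -
    have "?S (residual \<gamma> n H j) q = (LINT \<xi>|sphere_measure. lap (H (j + 2)) \<xi> * q \<xi> + (?ev n - ?ev j) * (H j \<xi> * q \<xi>))"
      by (simp add: residual_def algebra_simps)
    also have "\<dots> = ?S (lap (H (j + 2))) q + (?ev n - ?ev j) * ?S (H j) q"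
      using int[OF hom_poly_lap[OF H] q, of "j + 2"] int[OF H q, of j] by simp
    finally have S: "?S (residual \<gamma> n H j) q = ?S (lap (H (j + 2))) q + (?ev n - ?ev j) * ?S (H j) q" .
    show ?thesis unfolding S by (simp add: algebra_simps)
  qed
  then have "(\<Sum>j\<le>n. ?M (j + l) * ?S (residual \<gamma> n H j) q)
      = (\<Sum>j\<le>n. ?L (j + 2)) + (\<Sum>j\<le>n. (?ev n - ?ev j) * (?M (j + l) * ?S (H j) q))"
    by (simp add: sum.distrib)
  also have "\<dots> = (?ev n - ?ev l) * (\<Sum>j\<le>n. ?M (j + l) * ?S (H j) q)"
    unfolding A sum.distrib[symmetric] sum_distrib_left by (simp add: algebra_simps)
  also have "\<dots> = 0" using ortho[OF l q] by simp
  finally show ?thesis .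
qed

text \<open>The residual is tested against itself. In the double sum over degrees j and l, the terms
  with l < n cancel by \<open>residual_ortho\<close> and those with l = n vanish by
  \<open>residual_top\<close>, so its weighted square norm is zero.\<close>

lemma residual_eq_0:
  assumes t: "\<rho> < \<bar>t\<bar>" "\<bar>t\<bar> \<le> sqrt (\<rho>\<^sup>2 + 1)" and \<xi>: "norm \<xi> = 1"
  shows "(\<Sum>j\<le>n. residual \<gamma> n H j (sqrt (t\<^sup>2 - \<rho>\<^sup>2) *\<^sub>R \<xi>)) = 0"
proof -
  let ?b = "sqrt (\<rho>\<^sup>2 + 1)"
  let ?R = "residual \<gamma> n H"
  let ?S = "\<lambda>j l. LINT \<xi>|sphere_measure. ?R j \<xi> * ?R l \<xi>"
  let ?r = "\<lambda>t. sqrt (t\<^sup>2 - \<rho>\<^sup>2)"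
  let ?W = "radial_weight \<rho> \<gamma>"
  \<comment> \<open>Two forms of q are needed: this finite sum is visibly continuous and matches the
    moments, while as the integral of a square q is nonnegative.\<close>
  define q where "q s = (\<Sum>l\<le>n. \<Sum>j\<le>n. ?r s ^ (j + l) * ?S j l)" for s
  note R = hom_poly_residual[OF H]
  have q: "q s = (LINT \<xi>|sphere_measure. (\<Sum>j\<le>n. ?R j (?r s *\<^sub>R \<xi>))\<^sup>2)" for s
  proof -
    have "(\<Sum>j\<le>n. ?R j (?r s *\<^sub>R \<xi>))\<^sup>2 = (\<Sum>l\<le>n. \<Sum>j\<le>n. ?r s ^ (j + l) * (?R j \<xi> * ?R l \<xi>))" for \<xi> :: "real^'d"
      unfolding power2_eq_square sum_product
      by (subst sum.swap) (simp add: hom_poly_scaleR[OF R] power_add algebra_simps)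
    then show ?thesis
      using hom_poly_sphere_integrable[OF hom_poly_mult[OF R R]]
      by (simp add: q_def Bochner_Integration.integral_sum)
  qed
  have q_nonneg: "0 \<le> q s" for s
    unfolding q by (rule Bochner_Integration.integral_nonneg) simp
  have q_cont: "continuous_on UNIV q"
    unfolding q_def[abs_def] by (intro continuous_intros)
  have int: "set_integrable lborel {\<rho><..<?b} (\<lambda>s. ?W a s * c)" for a c
    by (intro set_integrable_mult_left set_integrable_radial_weight \<rho> \<gamma>)
  have Wq: "(\<Sum>l\<le>n. \<Sum>j\<le>n. ?W (j + l + CARD('d) - 2) s * ?S j l) = ?W (CARD('d) - 2) s * q s" for s
  proof -
    have "?W (j + l + CARD('d) - 2) s = ?W (CARD('d) - 2) s * ?r s ^ (j + l)" for j l
      using d by (simp add: radial_weight_def power_add[symmetric] ac_simps)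
    then show ?thesis by (simp add: q_def sum_distrib_left ac_simps)
  qed
  have "(\<Sum>j\<le>n. radial_moment \<rho> \<gamma> (j + l + CARD('d) - 2) * ?S j l) = 0" for l
    using residual_ortho[OF _ R, of l] residual_top[of l] by (cases "l < n") auto
  then have "0 = (\<Sum>l\<le>n. \<Sum>j\<le>n. radial_moment \<rho> \<gamma> (j + l + CARD('d) - 2) * ?S j l)"
    by simp
  also have "\<dots> = (\<Sum>l\<le>n. \<Sum>j\<le>n. (LINT s:{\<rho><..<?b}|lborel. ?W (j + l + CARD('d) - 2) s * ?S j l))"
    by (simp add: radial_moment_def)
  also have "\<dots> = (LINT s:{\<rho><..<?b}|lborel. (\<Sum>l\<le>n. \<Sum>j\<le>n. ?W (j + l + CARD('d) - 2) s * ?S j l))"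
    by (simp only: set_integral_sum set_integrable_sum int)
  also have "\<dots> = (LINT s:{\<rho><..<?b}|lborel. ?W (CARD('d) - 2) s * q s)"
    by (simp only: Wq)
  finally have "(LINT s:{\<rho><..<?b}|lborel. ?W (CARD('d) - 2) s * q s) = 0" by simp
  moreover have "set_integrable lborel {\<rho><..<?b} (\<lambda>s. ?W (CARD('d) - 2) s * q s)"
    unfolding Wq[symmetric] by (intro set_integrable_sum int)
  moreover have W_pos: "?W (CARD('d) - 2) s > 0" if "s \<in> {\<rho><..<?b}" for s
    using that radial_bounds[OF \<rho> \<gamma>, of s] \<rho> by (simp add: radial_weight_def)
  ultimately have "AE s in lborel. indicat_real {\<rho><..<?b} s *\<^sub>R (?W (CARD('d) - 2) s * q s) = 0"
    unfolding set_lebesgue_integral_def set_integrable_def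
    by (subst (asm) integral_nonneg_eq_0_iff_AE) (auto simp: indicator_def q_nonneg less_imp_le)
  define U where "U = {\<rho><..<?b} \<inter> q -` (- {0})"
  have "open U"
    unfolding U_def by (intro continuous_open_preimage continuous_on_subset[OF q_cont]) auto
  moreover have "AE s in lborel. s \<notin> U"
    using \<open>AE s in lborel. _ s = 0\<close>
    by eventually_elim (use W_pos in \<open>fastforce simp: U_def indicator_def\<close>)
  ultimately have "U = {}" by (rule open_AE_lborel_empty)
  then have q0: "q s = 0" if "s \<in> {\<rho><..<?b}" for s
    using that by (auto simp: U_def)
  \<comment> \<open>q depends on \<open>s^2\<close> only, so |t| covers both sheets; the closure
    adds the outer end point, which lies outside the open interval where the weight is known to be
    positive.\<close>
  have "\<bar>t\<bar> \<in> closure {\<rho><..<?b}"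
    unfolding closure_greaterThanLessThan[OF rho_less[OF \<rho> \<gamma>]] using t by simp
  then have "q \<bar>t\<bar> = 0"
    using q0 by (rule continuous_constant_on_closure[OF continuous_on_subset[OF q_cont subset_UNIV], rotated 1])
  then have "(LINT \<xi>|sphere_measure. (\<Sum>j\<le>n. ?R j (?r t *\<^sub>R \<xi>))\<^sup>2) = 0"
    unfolding q by simp
  moreover have "continuous_on UNIV (\<lambda>\<xi>. (\<Sum>j\<le>n. ?R j (?r t *\<^sub>R \<xi>))\<^sup>2)"
    unfolding hom_poly_scaleR[OF R] by (intro continuous_intros hom_poly_continuous[OF R])
  ultimately have "(\<Sum>j\<le>n. ?R j (?r t *\<^sub>R \<xi>))\<^sup>2 = 0"
    using \<xi> by (intro sphere_integral_eq_0D[where f = "\<lambda>\<xi>. (\<Sum>j\<le>n. ?R j (?r t *\<^sub>R \<xi>))\<^sup>2"]) simp_all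
  then show ?thesis by simp
qed

end

end

section \<open>Polynomials on the hyperboloid and the operator in coordinates\<close>

lemma finite_exponents:
  "finite {(\<alpha> :: 'd::finite \<Rightarrow> nat, k). (\<Sum>i\<in>UNIV. \<alpha> i) + k \<le> n}"
proof (rule finite_subset)
  show "{(\<alpha> :: 'd \<Rightarrow> nat, k). (\<Sum>i\<in>UNIV. \<alpha> i) + k \<le> n} \<subseteq> (UNIV \<rightarrow>\<^sub>E {..n}) \<times> {..n}"
  proof clarify
    fix \<alpha> :: "'d \<Rightarrow> nat" and k
    assume le: "(\<Sum>i\<in>UNIV. \<alpha> i) + k \<le> n"
    have "\<alpha> i \<le> (\<Sum>i\<in>UNIV. \<alpha> i)" for i
      by (rule member_le_sum) auto
    then have "\<alpha> i \<le> n" for i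
      using le by (meson add_leD1 order_trans)
    then show "\<alpha> \<in> UNIV \<rightarrow>\<^sub>E {..n} \<and> k \<in> {..n}"
      using le by auto
  qed
qed (intro finite_cartesian_product finite_PiE; simp)

lemma polynomials_upto_add:
  assumes "p \<in> polynomials_upto n" "q \<in> polynomials_upto n"
  shows "(\<lambda>z. p z + q z) \<in> polynomials_upto n"
proof -
  obtain c c' where
    "\<And>x t. p (x, t) = (\<Sum>(\<alpha>, k)\<in>{(\<alpha>, k). (\<Sum>i\<in>UNIV. \<alpha> i) + k \<le> n}. c \<alpha> k * (\<Prod>i\<in>UNIV. (x $ i) ^ \<alpha> i) * t ^ k)"
    "\<And>x t. q (x, t) = (\<Sum>(\<alpha>, k)\<in>{(\<alpha>, k). (\<Sum>i\<in>UNIV. \<alpha> i) + k \<le> n}. c' \<alpha> k * (\<Prod>i\<in>UNIV. (x $ i) ^ \<alpha> i) * t ^ k)"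
    using assms unfolding polynomials_upto_def by blast
  then show ?thesis
    unfolding polynomials_upto_def
    by (intro CollectI exI[of _ "\<lambda>\<alpha> k. c \<alpha> k + c' \<alpha> k"])
      (simp add: sum.distrib[symmetric] algebra_simps case_prod_unfold)
qed

lemma polynomials_upto_monomial:
  fixes \<beta> :: "'d::finite \<Rightarrow> nat"
  assumes "(\<Sum>i\<in>UNIV. \<beta> i) \<le> n"
  shows "(\<lambda>(x, t). c * (\<Prod>i\<in>UNIV. (x $ i) ^ \<beta> i)) \<in> polynomials_upto n"
proof -
  let ?A = "{(\<alpha>, k). (\<Sum>i\<in>UNIV. \<alpha> i) + k \<le> n} :: (('d \<Rightarrow> nat) \<times> nat) set"
  have "(\<Sum>(\<alpha>, k)\<in>?A. (if \<alpha> = \<beta> \<and> k = 0 then c else 0) * (\<Prod>i\<in>UNIV. (x $ i) ^ \<alpha> i) * t ^ k)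
      = c * (\<Prod>i\<in>UNIV. (x $ i) ^ \<beta> i)" for x :: "real^'d" and t :: real
  proof -
    have "(\<Sum>(\<alpha>, k)\<in>?A. (if \<alpha> = \<beta> \<and> k = 0 then c else 0) * (\<Prod>i\<in>UNIV. (x $ i) ^ \<alpha> i) * t ^ k)
      = (\<Sum>z\<in>?A. if z = (\<beta>, 0) then c * (\<Prod>i\<in>UNIV. (x $ i) ^ \<beta> i) else 0)"
    proof (intro sum.cong refl)
      fix z :: "('d \<Rightarrow> nat) \<times> nat"
      show "(case z of (\<alpha>, k) \<Rightarrow> (if \<alpha> = \<beta> \<and> k = 0 then c else 0) * (\<Prod>i\<in>UNIV. (x $ i) ^ \<alpha> i) * t ^ k)
          = (if z = (\<beta>, 0) then c * (\<Prod>i\<in>UNIV. (x $ i) ^ \<beta> i) else 0)"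
        by (cases z; cases "z = (\<beta>, 0)") auto
    qed
    also have "\<dots> = c * (\<Prod>i\<in>UNIV. (x $ i) ^ \<beta> i)"
      using assms by (subst sum.delta[OF finite_exponents]) simp
    finally show ?thesis .
  qed
  then show ?thesis
    unfolding polynomials_upto_def
    by (intro CollectI exI[of _ "\<lambda>\<alpha> k. if \<alpha> = \<beta> \<and> k = 0 then c else 0"]) simp
qed

text \<open>The induction carries an extra monomial factor with exponent \<beta>: each coordinate
  rule is absorbed into \<beta>, and only monomials remain at the base.\<close>

lemma hom_poly_in_polynomials_upto:
  fixes f :: "real^'d \<Rightarrow> real"
  assumes "hom_poly k f"
  shows "(\<lambda>(x, t). f x) \<in> polynomials_upto k"
proof -
  have "(\<lambda>(x, t). f x * (\<Prod>i\<in>UNIV. (x $ i) ^ \<beta> i)) \<in> polynomials_upto (k + (\<Sum>i\<in>UNIV. \<beta> i))" for \<beta>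
    using assms
  proof (induction arbitrary: \<beta>)
    case (const c)
    show ?case by (rule polynomials_upto_monomial) simp
  next
    case (coord k f i)
    have "(\<Prod>j\<in>UNIV. (x $ j) ^ (\<beta>(i := Suc (\<beta> i))) j) = x $ i * (\<Prod>j\<in>UNIV. (x $ j) ^ \<beta> j)" for x :: "real^'d"
      by (simp add: prod.remove[of UNIV i] ac_simps)
    moreover have "(\<Sum>j\<in>UNIV. (\<beta>(i := Suc (\<beta> i))) j) = Suc (\<Sum>j\<in>UNIV. \<beta> j)"
      by (simp add: sum.remove[of UNIV i])
    ultimately show ?case
      using coord.IH[of "\<beta>(i := Suc (\<beta> i))"] by (simp add: ac_simps)
  next
    case (add k f g)
    from polynomials_upto_add[OF add.IH] show ?case
      by (simp add: case_prod_unfold algebra_simps)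
  qed
  from this[of "\<lambda>_. 0"] show ?thesis by simp
qed

text \<open>The parts are indexed by all k and zero beyond n, so that \<open>H (j + 2)\<close> makes
  sense for every j in the residual.\<close>

definition ball_poly :: "nat \<Rightarrow> (real^'d \<Rightarrow> real) \<Rightarrow> bool" where
  "ball_poly n P \<longleftrightarrow> (\<exists>H. (\<forall>k. hom_poly k (H k)) \<and> (\<forall>k>n. \<forall>x. H k x = 0) \<and> (\<forall>x. P x = (\<Sum>k\<le>n. H k x)))"

lemma ball_poly_hom:
  assumes "hom_poly k f" "k \<le> n"
  shows "ball_poly n f"
proof -
  have "(\<Sum>j\<le>n. if j = k then f x else 0) = f x" for x
    using assms(2) by simp
  then show ?thesis
    unfolding ball_poly_def
  proof (intro exI[of _ "\<lambda>j x. if j = k then f x else 0"] conjI allI impI)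
    show "hom_poly j (\<lambda>x. if j = k then f x else 0)" for j
      using assms(1) by (cases "j = k") (simp_all add: hom_poly_zero)
  qed (use assms(2) in auto)
qed

lemma ball_poly_add:
  assumes "ball_poly n P" "ball_poly n Q"
  shows "ball_poly n (\<lambda>x. P x + Q x)"
proof -
  obtain F G where "\<And>k. hom_poly k (F k)" "\<And>k x. k > n \<Longrightarrow> F k x = 0" "\<And>x. P x = (\<Sum>k\<le>n. F k x)"
    "\<And>k. hom_poly k (G k)" "\<And>k x. k > n \<Longrightarrow> G k x = 0" "\<And>x. Q x = (\<Sum>k\<le>n. G k x)"
    using assms unfolding ball_poly_def by blast
  then show ?thesis
    unfolding ball_poly_def
    by (intro exI[of _ "\<lambda>k x. F k x + G k x"]) (auto simp: sum.distrib intro: hom_poly.add)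
qed

lemma ball_poly_sum:
  assumes "finite I" "\<And>i. i \<in> I \<Longrightarrow> ball_poly n (f i)"
  shows "ball_poly n (\<lambda>x. \<Sum>i\<in>I. f i x)"
  using assms by (induction I rule: finite_induct)
    (auto intro: ball_poly_add ball_poly_hom[OF hom_poly_zero, of 0])

lemma ball_poly_mult_hom:
  assumes P: "ball_poly n P" and g: "hom_poly l g" and "n + l \<le> m"
  shows "ball_poly m (\<lambda>x. P x * g x)"
proof -
  obtain F where F: "\<And>k. hom_poly k (F k)" "\<And>x. P x = (\<Sum>k\<le>n. F k x)"
    using P unfolding ball_poly_def by blast
  have "ball_poly m (\<lambda>x. \<Sum>k\<le>n. F k x * g x)"
    using assms(3) by (intro ball_poly_sum ball_poly_hom[OF hom_poly_mult[OF F(1) g]]) auto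
  then show ?thesis by (simp add: F(2) sum_distrib_right)
qed

text \<open>On the hyperboloid \<open>t\<^sup>2 = \<parallel>x\<parallel>\<^sup>2 + \<rho>\<^sup>2\<close>.\<close>

lemma ball_poly_t_power:
  assumes P: "ball_poly n P"
  shows "ball_poly (n + 2 * m) (\<lambda>x. P x * ((norm x)\<^sup>2 + \<rho>\<^sup>2) ^ m)"
proof (induction m)
  case (Suc m)
  have "ball_poly (n + 2 * Suc m) (\<lambda>x. P x * ((norm x)\<^sup>2 + \<rho>\<^sup>2) ^ m * (norm x)\<^sup>2
      + P x * ((norm x)\<^sup>2 + \<rho>\<^sup>2) ^ m * \<rho>\<^sup>2)"
    by (intro ball_poly_add ball_poly_mult_hom[OF Suc hom_poly_norm_power2] ball_poly_mult_hom[OF Suc hom_poly.const]) auto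
  then show ?case by (simp add: algebra_simps)
qed (use P in simp)

text \<open>Replacing an even power \<open>t^k\<close> by \<open>(|x|^2 + \<rho>^2)^(k/2)\<close>
  does not raise the degree, so the bound n survives the elimination of t.\<close>

lemma even_ortho_polys_ball_poly:
  fixes u :: "(real^'d) \<times> real \<Rightarrow> real"
  assumes "u \<in> even_ortho_polys \<rho> w n"
  obtains P where "ball_poly n P" "\<And>x t. (x, t) \<in> hyperboloid \<rho> \<Longrightarrow> u (x, t) = P x"
proof -
  let ?A = "{(\<alpha>, k). (\<Sum>i\<in>UNIV. \<alpha> i) + k \<le> n} :: (('d \<Rightarrow> nat) \<times> nat) set"
  let ?m = "\<lambda>\<alpha> x. \<Prod>i\<in>UNIV. (x $ i) ^ \<alpha> i"
  obtain p c where up: "\<And>z. z \<in> hyperboloid \<rho> \<Longrightarrow> u z = p z"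
    and p: "\<And>x t. p (x, t) = (\<Sum>(\<alpha>, k)\<in>?A. c \<alpha> k * ?m \<alpha> x * t ^ k)"
    and even: "\<And>x t. (x, t) \<in> hyperboloid \<rho> \<Longrightarrow> u (x, - t) = u (x, t)"
    using assms unfolding even_ortho_polys_def polynomials_upto_def by blast
  define P where "P x = (\<Sum>z\<in>?A. if even (snd z) then c (fst z) (snd z) * ?m (fst z) x * ((norm x)\<^sup>2 + \<rho>\<^sup>2) ^ (snd z div 2) else 0)"
    for x :: "real^'d"
  have "ball_poly n P"
    unfolding P_def[abs_def]
  proof (rule ball_poly_sum[OF finite_exponents])
    fix z assume "z \<in> ?A"
    then obtain \<alpha> k where z: "z = (\<alpha>, k)" and le: "(\<Sum>i\<in>UNIV. \<alpha> i) + k \<le> n" by auto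
    show "ball_poly n (\<lambda>x. if even (snd z) then c (fst z) (snd z) * ?m (fst z) x * ((norm x)\<^sup>2 + \<rho>\<^sup>2) ^ (snd z div 2) else 0)"
    proof (cases "even k")
      case True
      have "ball_poly (n - k) (\<lambda>x. c \<alpha> k * ?m \<alpha> x)"
        using le by (intro ball_poly_hom[OF hom_poly_cmult[OF hom_poly_monomial]]) simp
      from ball_poly_t_power[OF this, of "k div 2" \<rho>] show ?thesis
        using True le by (simp add: z)
    next
      case False
      then show ?thesis by (simp add: z ball_poly_hom[OF hom_poly_zero, of 0])
    qed
  qed
  moreover have "u (x, t) = P x" if xt: "(x, t) \<in> hyperboloid \<rho>" for x t
  proof -
    from xt have xt': "(x, - t) \<in> hyperboloid \<rho>" and t: "t\<^sup>2 = (norm x)\<^sup>2 + \<rho>\<^sup>2"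
      by (auto simp: hyperboloid_def)
    \<comment> \<open>Evenness is given for u on the hyperboloid, not for the representing p;
      averaging over the two sheets removes the odd powers of t.\<close>
    have "u (x, t) = (p (x, t) + p (x, - t)) / 2"
      using up[OF xt] up[OF xt'] even[OF xt] by simp
    also have "\<dots> = (\<Sum>(\<alpha>, k)\<in>?A. c \<alpha> k * ?m \<alpha> x * ((t ^ k + (- t) ^ k) / 2))"
      unfolding p by (simp add: sum.distrib[symmetric] sum_divide_distrib case_prod_unfold field_simps)
    also have "\<dots> = P x"
      unfolding P_def
    proof (intro sum.cong refl)
      fix z :: "('d \<Rightarrow> nat) \<times> nat"
      have "even k \<Longrightarrow> t ^ k = ((norm x)\<^sup>2 + \<rho>\<^sup>2) ^ (k div 2)" for k
        by (simp add: t[symmetric] power_mult[symmetric])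
      then show "(case z of (\<alpha>, k) \<Rightarrow> c \<alpha> k * ?m \<alpha> x * ((t ^ k + (- t) ^ k) / 2))
          = (if even (snd z) then c (fst z) (snd z) * ?m (fst z) x * ((norm x)\<^sup>2 + \<rho>\<^sup>2) ^ (snd z div 2) else 0)"
        by (cases "even (snd z)") (simp_all add: case_prod_unfold)
    qed
    finally show ?thesis .
  qed
  ultimately show ?thesis by (rule that)
qed

section \<open>Angular and radial derivatives of homogeneous expansions\<close>

lemma hom_poly_has_derivative_axis:
  assumes "hom_poly k f"
  shows "((\<lambda>s. f (x + s *\<^sub>R axis i 1)) has_real_derivative pderiv_at i f (x + s *\<^sub>R axis i 1)) (at s)"
proof -
  have "((\<lambda>s. x + s *\<^sub>R axis i 1) has_derivative (\<lambda>h. h *\<^sub>R axis i 1)) (at s)"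
    by (auto intro!: derivative_eq_intros)
  from has_derivative_compose[OF this hom_poly_has_derivative[OF assms]]
  have "((\<lambda>s. f (x + s *\<^sub>R axis i 1)) has_derivative
      (\<lambda>h. \<Sum>j\<in>UNIV. (h *\<^sub>R axis i 1) $ j * pderiv_at j f (x + s *\<^sub>R axis i 1))) (at s)" .
  also have "(\<lambda>h. \<Sum>j\<in>UNIV. (h *\<^sub>R axis i 1) $ j * pderiv_at j f (x + s *\<^sub>R axis i 1))
      = (*) (pderiv_at i f (x + s *\<^sub>R axis i 1))"
  proof
    fix h :: real
    have "(\<Sum>j\<in>UNIV. (h *\<^sub>R axis i 1) $ j * pderiv_at j f (x + s *\<^sub>R axis i 1))
        = (\<Sum>j\<in>UNIV. if j = i then pderiv_at i f (x + s *\<^sub>R axis i 1) * h else 0)"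
      by (intro sum.cong) (auto simp: axis_def)
    then show "(\<Sum>j\<in>UNIV. (h *\<^sub>R axis i 1) $ j * pderiv_at j f (x + s *\<^sub>R axis i 1))
        = pderiv_at i f (x + s *\<^sub>R axis i 1) * h" by simp
  qed
  finally show ?thesis by (simp add: has_field_derivative_def)
qed

lemma laplacian_vec: "laplacian f x = (\<Sum>i\<in>UNIV. (deriv ^^ 2) (\<lambda>s. f (x + s *\<^sub>R axis i 1)) 0)"
  for f :: "real^'d \<Rightarrow> real"
proof -
  have B: "(Basis :: (real^'d) set) = range (\<lambda>i. axis i 1)"
    by (auto simp: Basis_vec_def)
  have inj: "inj (\<lambda>i. axis i 1 :: real^'d)"
    by (auto simp: inj_def axis_eq_axis)
  show ?thesis
    unfolding laplacian_def B sum.reindex[OF inj] o_def ..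
qed

text \<open>The extension of \<open>H k\<close> constant along rays is
  \<open>H k y * |y| powr (- deg k)\<close>. Its second derivatives at \<xi> along the axes are
  computed from the product rule, with N the squared norm along the axis line.\<close>

lemma laplace_beltrami_sphere_hom_sum:
  fixes H :: "'k \<Rightarrow> real^'d \<Rightarrow> real"
  assumes H: "\<And>k. k \<in> K \<Longrightarrow> hom_poly (deg k) (H k)"
    and f: "\<And>\<eta>. norm \<eta> = 1 \<Longrightarrow> f \<eta> = (\<Sum>k\<in>K. c k * H k \<eta>)" and \<xi>: "norm \<xi> = 1"
  shows "laplace_beltrami_sphere f \<xi>
    = (\<Sum>k\<in>K. c k * (lap (H k) \<xi> - real (deg k) * (real (deg k) + real CARD('d) - 2) * H k \<xi>))"
proof -
  have second: "(deriv ^^ 2) (\<lambda>s. f (sgn (\<xi> + s *\<^sub>R axis i 1))) 0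
    = (\<Sum>k\<in>K. c k * (pderiv_at i (pderiv_at i (H k)) \<xi> - 2 * real (deg k) * (\<xi> $ i * pderiv_at i (H k) \<xi>)
        + (real (deg k) * (real (deg k) + 2) * (\<xi> $ i)\<^sup>2 - real (deg k)) * H k \<xi>))" for i
  proof -
    let ?y = "\<lambda>s. \<xi> + s *\<^sub>R axis i (1::real)"
    define N where "N s = 1 + 2 * \<xi> $ i * s + s\<^sup>2" for s
    define \<phi> where "\<phi> s = (\<Sum>k\<in>K. c k * (H k (?y s) * N s powr (- real (deg k) / 2)))" for s
    define \<phi>' where "\<phi>' s = (\<Sum>k\<in>K. c k * (pderiv_at i (H k) (?y s) * N s powr (- real (deg k) / 2)
        - real (deg k) * (\<xi> $ i + s) * H k (?y s) * N s powr (- real (deg k) / 2 - 1)))" for s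
    have norm2: "(norm (?y s))\<^sup>2 = N s" for s
    proof -
      have "inner \<xi> \<xi> = 1" using \<xi> by (simp add: norm_eq_1)
      then show ?thesis
        unfolding power2_norm_eq_inner
        by (simp add: N_def inner_simps inner_axis inner_axis' power2_eq_square algebra_simps)
    qed
    have nz: "?y s \<noteq> 0" if "\<bar>s\<bar> < 1" for s
    proof
      assume "?y s = 0"
      then have "\<xi> = - (s *\<^sub>R axis i 1)" by (rule eq_neg_iff_add_eq_0[THEN iffD2])
      then have "norm \<xi> = \<bar>s\<bar>" by simp
      with \<xi> that show False by simp
    qed
    have Npos: "N s > 0" if "\<bar>s\<bar> < 1" for s
      unfolding norm2[symmetric] using nz[OF that] by simp
    have N0: "N 0 = 1" by (simp add: N_def)
    have dN: "(N has_real_derivative 2 * (\<xi> $ i + s)) (at s)" for s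
      unfolding N_def[abs_def] by (auto intro!: derivative_eq_intros)
    have eq: "f (sgn (?y s)) = \<phi> s" if "\<bar>s\<bar> < 1" for s
    proof -
      have "inverse (norm (?y s)) ^ m = N s powr (- real m / 2)" for m
      proof -
        have "norm (?y s) = N s powr (1 / 2)"
          using Npos[OF that] norm2[of s] by (simp add: powr_half_sqrt real_sqrt_unique)
        then have "norm (?y s) ^ m = N s powr (real m / 2)"
          using Npos[OF that] by (simp add: powr_realpow[symmetric] powr_powr)
        then show ?thesis by (simp add: power_inverse powr_minus)
      qed
      then have "H k (sgn (?y s)) = H k (?y s) * N s powr (- real (deg k) / 2)" if "k \<in> K" for k
        using hom_poly_scaleR[OF H[OF that]] by (simp add: sgn_div_norm)
      then show ?thesis
        using nz[OF that] by (simp add: f norm_sgn \<phi>_def)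
    qed
    have d\<phi>: "(\<phi> has_real_derivative \<phi>' s) (at s)" if "\<bar>s\<bar> < 1" for s
      unfolding \<phi>_def[abs_def] \<phi>'_def
    proof (intro DERIV_sum DERIV_cmult)
      fix k assume k: "k \<in> K"
      show "((\<lambda>s. H k (?y s) * N s powr (- real (deg k) / 2)) has_real_derivative
          pderiv_at i (H k) (?y s) * N s powr (- real (deg k) / 2)
          - real (deg k) * (\<xi> $ i + s) * H k (?y s) * N s powr (- real (deg k) / 2 - 1)) (at s)"
        by (rule DERIV_cong[OF DERIV_mult[OF hom_poly_has_derivative_axis[OF H[OF k]] DERIV_fun_powr[OF dN Npos[OF that]]]])
          (simp add: algebra_simps)
    qed
    have d\<phi>': "(\<phi>' has_real_derivative (\<Sum>k\<in>K. c k * (pderiv_at i (pderiv_at i (H k)) \<xi>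
        - 2 * real (deg k) * (\<xi> $ i * pderiv_at i (H k) \<xi>)
        + (real (deg k) * (real (deg k) + 2) * (\<xi> $ i)\<^sup>2 - real (deg k)) * H k \<xi>))) (at 0)"
      unfolding \<phi>'_def[abs_def]
    proof (intro DERIV_sum DERIV_cmult)
      fix k assume k: "k \<in> K"
      have lin: "((\<lambda>s. real (deg k) * (\<xi> $ i + s)) has_real_derivative real (deg k)) (at 0)"
        by (auto intro!: derivative_eq_intros)
      have N0pos: "N 0 > 0" by (simp add: N0)
      note dH = hom_poly_has_derivative_axis[OF H[OF k], of \<xi> i 0]
        and ddH = hom_poly_has_derivative_axis[OF hom_poly_pderiv[OF H[OF k]], of i \<xi> i 0]
        and pow = DERIV_fun_powr[OF dN N0pos]
      show "((\<lambda>s. pderiv_at i (H k) (?y s) * N s powr (- real (deg k) / 2)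
          - real (deg k) * (\<xi> $ i + s) * H k (?y s) * N s powr (- real (deg k) / 2 - 1)) has_real_derivative
          pderiv_at i (pderiv_at i (H k)) \<xi> - 2 * real (deg k) * (\<xi> $ i * pderiv_at i (H k) \<xi>)
          + (real (deg k) * (real (deg k) + 2) * (\<xi> $ i)\<^sup>2 - real (deg k)) * H k \<xi>) (at 0)"
        by (rule DERIV_cong[OF DERIV_diff[OF DERIV_mult[OF ddH pow] DERIV_mult[OF DERIV_mult[OF lin dH] pow]]])
          (simp add: N0 power2_eq_square field_simps)
    qed
    \<comment> \<open>The second derivative needs the first on a neighbourhood of 0; |s| < 1 keeps
      the line away from the origin because \<xi> has norm 1.\<close>
    have "deriv (\<lambda>s. f (sgn (?y s))) s = \<phi>' s" if "\<bar>s\<bar> < 1" for s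
    proof (rule DERIV_imp_deriv, rule has_field_derivative_transform_within_open[OF d\<phi>[OF that]])
      show "open {-1<..<1::real}" "s \<in> {-1<..<1}" using that by auto
      show "\<phi> z = f (sgn (?y z))" if "z \<in> {-1<..<1}" for z
        using that by (intro eq[symmetric]) auto
    qed
    then have "eventually (\<lambda>s. deriv (\<lambda>s. f (sgn (?y s))) s = \<phi>' s) (nhds 0)"
      by (intro eventually_nhds[THEN iffD2] exI[of _ "{-1<..<1}"]) auto
    then have "(deriv ^^ 2) (\<lambda>s. f (sgn (?y s))) 0 = deriv \<phi>' 0"
      unfolding numeral_2_eq_2 funpow.simps o_apply id_apply by (rule deriv_cong_ev) simp
    then show ?thesis
      unfolding DERIV_imp_deriv[OF d\<phi>'] .
  qed
  \<comment> \<open>With k the degree, Euler turns the mixed terms into -2 k^2, and the remaining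
    ones sum to k (k + 2) - k d; together they are -k (k + d - 2).\<close>
  have "(\<Sum>i\<in>UNIV. pderiv_at i (pderiv_at i (H k)) \<xi> - 2 * real (deg k) * (\<xi> $ i * pderiv_at i (H k) \<xi>)
        + (real (deg k) * (real (deg k) + 2) * (\<xi> $ i)\<^sup>2 - real (deg k)) * H k \<xi>)
    = lap (H k) \<xi> - real (deg k) * (real (deg k) + real CARD('d) - 2) * H k \<xi>" if k: "k \<in> K" for k
  proof -
    have "(\<Sum>i\<in>UNIV. (\<xi> $ i)\<^sup>2) = 1"
      using \<xi> by (simp add: norm_vec_def L2_set_def)
    then show ?thesis
      by (simp add: sum.distrib sum_subtractf sum_distrib_left[symmetric] sum_distrib_right[symmetric]
          hom_poly_euler[OF H[OF k]] lap_def[symmetric]) (simp add: algebra_simps)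
  qed
  then show ?thesis
    unfolding laplace_beltrami_sphere_def laplacian_vec second
    by (subst sum.swap) (simp add: sum_distrib_left[symmetric])
qed

text \<open>The point t is a limit of the admissible range from inside its sheet, also at the outer
  end, so the derivative within the range is unique and is inherited from a function G that is
  differentiable on both sides.\<close>

lemma D_t_eqI:
  assumes g: "\<And>s. \<rho> < \<bar>s\<bar> \<Longrightarrow> \<bar>s\<bar> \<le> sqrt (\<rho>\<^sup>2 + 1) \<Longrightarrow> g s = G s"
    and G: "(G has_real_derivative G') (at t)" and \<rho>: "\<rho> > 0"
    and t: "\<rho> < \<bar>t\<bar>" "\<bar>t\<bar> \<le> sqrt (\<rho>\<^sup>2 + 1)"
  shows "D_t \<rho> g t = G'"
proof -
  let ?K = "{s. \<rho> < \<bar>s\<bar> \<and> \<bar>s\<bar> \<le> sqrt (\<rho>\<^sup>2 + 1)}"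
  have "t islimpt ?K"
  proof (cases "t > 0")
    case True
    then have "t islimpt {\<rho><..<t}" using t by (simp add: islimpt_greaterThanLessThan2)
    then show ?thesis by (rule islimpt_subset) (use t \<rho> True in auto)
  next
    case False
    then have "t islimpt {t<..<- \<rho>}" using t by (simp add: islimpt_greaterThanLessThan1)
    then show ?thesis by (rule islimpt_subset) (use t \<rho> False in auto)
  qed
  then have "at t within ?K \<noteq> bot" by (simp add: trivial_limit_within)
  moreover have "(g has_vector_derivative G') (at t within ?K)"
  proof (rule has_vector_derivative_transform)
    show "(G has_vector_derivative G') (at t within ?K)"
      using G by (simp add: has_real_derivative_iff_has_vector_derivative has_vector_derivative_at_within)
  qed (use t g in auto)
  ultimately show ?thesis
    unfolding D_t_def by (rule vector_derivative_within)
qed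

text \<open>With \<open>r = sqrt (t\<^sup>2 - \<rho>\<^sup>2)\<close> one has \<open>\<partial>\<^sub>t = (t/r) \<partial>\<^sub>r\<close> and
  \<open>\<partial>\<^sub>t\<^sup>2 = (t\<^sup>2/r\<^sup>2) \<partial>\<^sub>r\<^sup>2 - (\<rho>\<^sup>2/r\<^sup>3) \<partial>\<^sub>r\<close>.\<close>

lemma
  fixes a :: "nat \<Rightarrow> real"
  assumes \<rho>: "\<rho> > 0" and t: "\<rho> < \<bar>t\<bar>" "\<bar>t\<bar> \<le> sqrt (\<rho>\<^sup>2 + 1)"
    and g: "\<And>s. \<rho> < \<bar>s\<bar> \<Longrightarrow> \<bar>s\<bar> \<le> sqrt (\<rho>\<^sup>2 + 1) \<Longrightarrow> g s = (\<Sum>k\<in>K. a k * sqrt (s\<^sup>2 - \<rho>\<^sup>2) ^ k)"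
  shows D_t_radial: "D_t \<rho> g t = (\<Sum>k\<in>K. a k * (real k * (t * sqrt (t\<^sup>2 - \<rho>\<^sup>2) ^ k / (t\<^sup>2 - \<rho>\<^sup>2))))"
    and D_t_D_t_radial: "D_t \<rho> (D_t \<rho> g) t = (\<Sum>k\<in>K. a k * (real k *
      ((real k - 1) * t\<^sup>2 - \<rho>\<^sup>2) * sqrt (t\<^sup>2 - \<rho>\<^sup>2) ^ k / (t\<^sup>2 - \<rho>\<^sup>2)\<^sup>2))"
proof -
  have pos: "0 < s\<^sup>2 - \<rho>\<^sup>2" if "\<rho> < \<bar>s\<bar>" for s
    using that \<rho> power_strict_mono[of \<rho> "\<bar>s\<bar>" 2] by simp
  have dpow: "((\<lambda>s. sqrt (s\<^sup>2 - \<rho>\<^sup>2) ^ k) has_real_derivative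
      real k * (s * sqrt (s\<^sup>2 - \<rho>\<^sup>2) ^ k / (s\<^sup>2 - \<rho>\<^sup>2))) (at s)" if "\<rho> < \<bar>s\<bar>" for s k
  proof -
    define r where "r = sqrt (s\<^sup>2 - \<rho>\<^sup>2)"
    have r: "r > 0" "r\<^sup>2 = s\<^sup>2 - \<rho>\<^sup>2" using pos[OF that] by (simp_all add: r_def)
    have "((\<lambda>s. sqrt (s\<^sup>2 - \<rho>\<^sup>2)) has_real_derivative s / r) (at s)"
      using pos[OF that] by (auto intro!: derivative_eq_intros simp: r_def field_simps)
    from DERIV_power[OF this, of k]
    show ?thesis
    proof (rule DERIV_cong)
      show "real k * (s / r * sqrt (s\<^sup>2 - \<rho>\<^sup>2) ^ (k - Suc 0)) = real k * (s * sqrt (s\<^sup>2 - \<rho>\<^sup>2) ^ k / (s\<^sup>2 - \<rho>\<^sup>2))"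
        unfolding r_def[symmetric] r(2)[symmetric]
        using r(1) by (cases k) (simp_all add: field_simps power2_eq_square)
    qed
  qed
  \<comment> \<open>Needed for all t in the range, since the second \<open>D_t\<close> acts on this
    function.\<close>
  have D1: "D_t \<rho> g t = (\<Sum>k\<in>K. a k * (real k * (t * sqrt (t\<^sup>2 - \<rho>\<^sup>2) ^ k / (t\<^sup>2 - \<rho>\<^sup>2))))"
    if t: "\<rho> < \<bar>t\<bar>" "\<bar>t\<bar> \<le> sqrt (\<rho>\<^sup>2 + 1)" for t
    by (rule D_t_eqI[OF g _ \<rho> t]) (use t in \<open>auto intro!: DERIV_sum DERIV_cmult dpow simp del: times_divide_eq_right\<close>)
  show "D_t \<rho> g t = (\<Sum>k\<in>K. a k * (real k * (t * sqrt (t\<^sup>2 - \<rho>\<^sup>2) ^ k / (t\<^sup>2 - \<rho>\<^sup>2))))"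
    by (rule D1[OF t])
  show "D_t \<rho> (D_t \<rho> g) t = (\<Sum>k\<in>K. a k * (real k *
      ((real k - 1) * t\<^sup>2 - \<rho>\<^sup>2) * sqrt (t\<^sup>2 - \<rho>\<^sup>2) ^ k / (t\<^sup>2 - \<rho>\<^sup>2)\<^sup>2))"
  proof (rule D_t_eqI[OF D1 _ \<rho> t])
    show "((\<lambda>s. \<Sum>k\<in>K. a k * (real k * (s * sqrt (s\<^sup>2 - \<rho>\<^sup>2) ^ k / (s\<^sup>2 - \<rho>\<^sup>2)))) has_real_derivative
      (\<Sum>k\<in>K. a k * (real k * ((real k - 1) * t\<^sup>2 - \<rho>\<^sup>2) * sqrt (t\<^sup>2 - \<rho>\<^sup>2) ^ k / (t\<^sup>2 - \<rho>\<^sup>2)\<^sup>2))) (at t)"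
    proof (intro DERIV_sum DERIV_cmult)
      fix k
      have y: "t\<^sup>2 - \<rho>\<^sup>2 > 0" by (rule pos[OF t(1)])
      have dy: "((\<lambda>s. s\<^sup>2 - \<rho>\<^sup>2) has_real_derivative 2 * t) (at t)"
        by (auto intro!: derivative_eq_intros)
      have "((\<lambda>s. s * sqrt (s\<^sup>2 - \<rho>\<^sup>2) ^ k / (s\<^sup>2 - \<rho>\<^sup>2)) has_real_derivative
          ((real k - 1) * t\<^sup>2 - \<rho>\<^sup>2) * sqrt (t\<^sup>2 - \<rho>\<^sup>2) ^ k / (t\<^sup>2 - \<rho>\<^sup>2)\<^sup>2) (at t)"
      proof (rule DERIV_cong[OF DERIV_divide[OF DERIV_mult[OF DERIV_ident dpow[OF t(1)]] dy]])
        define R where "R = sqrt (t\<^sup>2 - \<rho>\<^sup>2) ^ k"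
        define y where "y = t\<^sup>2 - \<rho>\<^sup>2"
        have "y > 0" and \<rho>2: "\<rho>\<^sup>2 = t\<^sup>2 - y" using y by (simp_all add: y_def)
        then show "((1 * sqrt (t\<^sup>2 - \<rho>\<^sup>2) ^ k + real k * (t * sqrt (t\<^sup>2 - \<rho>\<^sup>2) ^ k / (t\<^sup>2 - \<rho>\<^sup>2)) * t) * (t\<^sup>2 - \<rho>\<^sup>2)
            - t * sqrt (t\<^sup>2 - \<rho>\<^sup>2) ^ k * (2 * t)) / ((t\<^sup>2 - \<rho>\<^sup>2) * (t\<^sup>2 - \<rho>\<^sup>2))
          = ((real k - 1) * t\<^sup>2 - \<rho>\<^sup>2) * sqrt (t\<^sup>2 - \<rho>\<^sup>2) ^ k / (t\<^sup>2 - \<rho>\<^sup>2)\<^sup>2"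
          unfolding R_def[symmetric] y_def[symmetric] unfolding \<rho>2
          by (simp add: field_simps power2_eq_square)
      qed (use y in simp)
      from DERIV_cmult[OF this, of "real k"]
      show "((\<lambda>s. real k * (s * sqrt (s\<^sup>2 - \<rho>\<^sup>2) ^ k / (s\<^sup>2 - \<rho>\<^sup>2))) has_real_derivative
          real k * ((real k - 1) * t\<^sup>2 - \<rho>\<^sup>2) * sqrt (t\<^sup>2 - \<rho>\<^sup>2) ^ k / (t\<^sup>2 - \<rho>\<^sup>2)\<^sup>2) (at t)"
        by (simp add: mult.assoc)
    qed
  qed
qed

theorem theorem4p4:
  fixes \<rho> \<gamma> t :: real and n :: nat
    and u :: "(real^'d) \<times> real \<Rightarrow> real" and \<xi> :: "real^'d"
  assumes "CARD('d) \<ge> 2" and "\<rho> > 0" and "\<gamma> > - 1 / 2"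
    and "u \<in> even_ortho_polys \<rho> (w0 \<rho> \<gamma>) n"
    and "\<xi> \<in> sphere 0 1" and "\<rho> < \<bar>t\<bar>" and "\<bar>t\<bar> \<le> sqrt (\<rho>\<^sup>2 + 1)"
  shows
    "(1 + \<rho>\<^sup>2 - t\<^sup>2) * (1 - \<rho>\<^sup>2 / t\<^sup>2) * D_t \<rho> (D_t \<rho> (in_coords \<rho> u \<xi>)) t
     + ((1 + \<rho>\<^sup>2 - t\<^sup>2) * (\<rho>\<^sup>2 / t\<^sup>2) - (2 * \<gamma> + real CARD('d)) * (t\<^sup>2 - \<rho>\<^sup>2))
         * (1 / t) * D_t \<rho> (in_coords \<rho> u \<xi>) t
     + (real CARD('d) - 1) / t * D_t \<rho> (in_coords \<rho> u \<xi>) t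
     + 1 / (t\<^sup>2 - \<rho>\<^sup>2) * laplace_beltrami_sphere (\<lambda>\<eta>. in_coords \<rho> u \<eta> t) \<xi>
     = - (real n * (real n + 2 * \<gamma> + real CARD('d) - 1)) * in_coords \<rho> u \<xi> t"
proof -
  note d = assms(1) and \<rho> = assms(2) and \<gamma> = assms(3) and t = assms(6,7)
  let ?r = "\<lambda>t. sqrt (t\<^sup>2 - \<rho>\<^sup>2)"
  let ?ev = "ball_eigenvalue \<gamma> CARD('d)"
  have \<xi>: "norm \<xi> = 1" using assms(5) by simp
  obtain P where P: "ball_poly n P" and uP: "\<And>x t. (x, t) \<in> hyperboloid \<rho> \<Longrightarrow> u (x, t) = P x"
    using even_ortho_polys_ball_poly[OF assms(4)] by blast
  then obtain H where H: "\<And>k. hom_poly k (H k)" and H0: "\<And>k x. k > n \<Longrightarrow> H k x = 0"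
    and PH: "\<And>x. P x = (\<Sum>k\<le>n. H k x)"
    unfolding ball_poly_def by blast
  have u: "in_coords \<rho> u \<eta> s = (\<Sum>k\<le>n. H k \<eta> * ?r s ^ k)"
    if "norm \<eta> = 1" "\<rho> < \<bar>s\<bar>" "\<bar>s\<bar> \<le> sqrt (\<rho>\<^sup>2 + 1)" for \<eta> :: "real^'d" and s
  proof -
    have "(?r s *\<^sub>R \<eta>, s) \<in> hyperboloid \<rho>"
      using that radial_bounds_le[OF \<rho> \<gamma>, of s] by (simp add: hyperboloid_def power_mult_distrib)
    then show ?thesis
      by (simp add: in_coords_def uP PH hom_poly_scaleR[OF H] mult.commute)
  qed
  \<comment> \<open>Test polynomials free of t are the right ones, as the residual is itself a
    polynomial in x.\<close>
  have ortho: "(\<Sum>k\<le>n. radial_moment \<rho> \<gamma> (k + l + CARD('d) - 2) * (LINT \<xi>|sphere_measure. H k \<xi> * q \<xi>)) = 0"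
    if l: "l < n" and q: "hom_poly l q" for l and q :: "real^'d \<Rightarrow> real"
  proof -
    have "weighted_inner \<rho> (w0 \<rho> \<gamma>) u (\<lambda>(x, t). q x) = 0"
      using assms(4) l hom_poly_in_polynomials_upto[OF q] by (auto simp: even_ortho_polys_def)
    moreover have "weighted_inner \<rho> (w0 \<rho> \<gamma>) u (\<lambda>(x, t). q x)
      = 2 * (\<Sum>k\<le>n. radial_moment \<rho> \<gamma> (k + l + CARD('d) - 2) * (LINT \<xi>|sphere_measure. H k \<xi> * q \<xi>))"
      by (rule weighted_inner_eq_moments[OF \<rho> \<gamma> d hom_poly_mult[OF H q]])
        (simp add: uP PH sum_distrib_right)
    ultimately show ?thesis by simp
  qed
  have residual: "(\<Sum>k\<le>n. residual \<gamma> n H k (?r t *\<^sub>R \<xi>)) = 0"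
    using residual_eq_0[OF \<rho> \<gamma> d H H0 ortho t \<xi>] .
  define y where "y = t\<^sup>2 - \<rho>\<^sup>2"
  have y: "y > 0" "t\<^sup>2 = y + \<rho>\<^sup>2" "?r t = sqrt y"
    using t \<rho> power_strict_mono[of \<rho> "\<bar>t\<bar>" 2] by (auto simp: y_def)
  have t0: "t \<noteq> 0" using t \<rho> by auto
  have LB: "laplace_beltrami_sphere (\<lambda>\<eta>. in_coords \<rho> u \<eta> t) \<xi>
      = (\<Sum>k\<le>n. ?r t ^ k * (lap (H k) \<xi> - real k * (real k + real CARD('d) - 2) * H k \<xi>))"
    by (rule laplace_beltrami_sphere_hom_sum[OF H _ \<xi>]) (simp add: u t mult.commute)
  have D1: "D_t \<rho> (in_coords \<rho> u \<xi>) t = (\<Sum>k\<le>n. H k \<xi> * (real k * (t * ?r t ^ k / y)))"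
    unfolding y_def by (rule D_t_radial[OF \<rho> t]) (rule u[OF \<xi>])
  have D2: "D_t \<rho> (D_t \<rho> (in_coords \<rho> u \<xi>)) t
      = (\<Sum>k\<le>n. H k \<xi> * (real k * ((real k - 1) * t\<^sup>2 - \<rho>\<^sup>2) * ?r t ^ k / y\<^sup>2))"
    unfolding y_def by (rule D_t_D_t_radial[OF \<rho> t]) (rule u[OF \<xi>])
  \<comment> \<open>Dividing by \<open>y = r^2\<close> matches the degree k - 2 of
    \<open>lap (H k)\<close>; shifting by two gives the indexing of the residual.\<close>
  have lap_sum: "(\<Sum>k\<le>n. sqrt y ^ k / y * lap (H k) \<xi>) = (\<Sum>k\<le>n. sqrt y ^ k * lap (H (k + 2)) \<xi>)"
  proof -
    let ?L = "\<lambda>k. sqrt y ^ k / y * lap (H k) \<xi>"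
    have L0: "?L k = 0" if "k < 2 \<or> k > n" for k
      using that hom_poly_lap_eq_0[OF H, of k] lap_eq_0_of_zero[of "H k"] H0[of k] by auto
    have "(\<Sum>k\<le>n. ?L k) = (\<Sum>k\<in>{..n + 2}. ?L k)"
    proof (rule sum.mono_neutral_left)
      show "\<forall>k\<in>{..n + 2} - {..n}. ?L k = 0"
        by (intro ballI L0) auto
    qed auto
    also have "\<dots> = (\<Sum>k\<in>{2..n + 2}. ?L k)"
    proof (rule sum.mono_neutral_right)
      show "\<forall>k\<in>{..n + 2} - {2..n + 2}. ?L k = 0"
        by (intro ballI L0) auto
    qed auto
    also have "\<dots> = (\<Sum>k\<le>n. ?L (k + 2))"
      using sum.shift_bounds_cl_nat_ivl[of ?L 0 2 n] by (simp only: atLeast0AtMost add_0)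
    also have "\<dots> = (\<Sum>k\<le>n. sqrt y ^ k * lap (H (k + 2)) \<xi>)"
    proof -
      have "sqrt y ^ (k + 2) / y = sqrt y ^ k" for k
        using y(1) by (simp only: power_add) simp
      then show ?thesis by (simp only:)
    qed
    finally show ?thesis .
  qed
  define A where "A = (1 + \<rho>\<^sup>2 - t\<^sup>2) * (1 - \<rho>\<^sup>2 / t\<^sup>2)"
  define B where "B = ((1 + \<rho>\<^sup>2 - t\<^sup>2) * (\<rho>\<^sup>2 / t\<^sup>2) - (2 * \<gamma> + real CARD('d)) * (t\<^sup>2 - \<rho>\<^sup>2)) * (1 / t) + (real CARD('d) - 1) / t"
  \<comment> \<open>The operator acts on each degree separately. The \<rho>-terms of A and B cancel,
    the \<open>1/y\<close> terms cancel against the angular part \<open>- k (k + d - 2) / y\<close>,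
    and what is left is minus the eigenvalue.\<close>
  have radial: "A * (H k \<xi> * (real k * ((real k - 1) * t\<^sup>2 - \<rho>\<^sup>2) * sqrt y ^ k / y\<^sup>2))
      + B * (H k \<xi> * (real k * (t * sqrt y ^ k / y)))
      + 1 / y * (sqrt y ^ k * (lap (H k) \<xi> - real k * (real k + real CARD('d) - 2) * H k \<xi>))
    = sqrt y ^ k / y * lap (H k) \<xi> - ?ev k * (sqrt y ^ k * H k \<xi>)" for k
  proof -
    have "y + \<rho>\<^sup>2 > 0" using y(1) by (simp add: add_pos_nonneg)
    then have A: "A * (real k * ((real k - 1) * t\<^sup>2 - \<rho>\<^sup>2) / y\<^sup>2)
        = (1 - y) * real k * ((real k - 1) / y - \<rho>\<^sup>2 / (y * (y + \<rho>\<^sup>2)))"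
      unfolding A_def y(2) using y(1) by (simp add: divide_simps) (simp add: algebra_simps power2_eq_square)
    have B: "B * (real k * (t / y)) = real k * ((1 - y) * \<rho>\<^sup>2 / (y * (y + \<rho>\<^sup>2)) - (2 * \<gamma> + real CARD('d)) + (real CARD('d) - 1) / y)"
    proof -
      have "B * t = (1 - y) * (\<rho>\<^sup>2 / (y + \<rho>\<^sup>2)) - (2 * \<gamma> + real CARD('d)) * y + (real CARD('d) - 1)"
        unfolding B_def distrib_right using t0 by (simp add: y(2))
      then have "B * (real k * (t / y)) = real k * ((1 - y) * (\<rho>\<^sup>2 / (y + \<rho>\<^sup>2)) - (2 * \<gamma> + real CARD('d)) * y + (real CARD('d) - 1)) / y"
        by (metis (no_types, opaque_lifting) mult.assoc mult.commute times_divide_eq_right)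
      then show ?thesis using y(1) by (simp add: add_divide_distrib diff_divide_distrib right_diff_distrib distrib_left mult.commute)
    qed
    have "A * (real k * ((real k - 1) * t\<^sup>2 - \<rho>\<^sup>2) / y\<^sup>2) + B * (real k * (t / y))
        - real k * (real k + real CARD('d) - 2) / y = - ?ev k"
      unfolding A B ball_eigenvalue_def using y(1)
      by (simp add: diff_divide_distrib add_divide_distrib algebra_simps)
    then have "(A * (real k * ((real k - 1) * t\<^sup>2 - \<rho>\<^sup>2) / y\<^sup>2) + B * (real k * (t / y))
        - real k * (real k + real CARD('d) - 2) / y) * (sqrt y ^ k * H k \<xi>) = - ?ev k * (sqrt y ^ k * H k \<xi>)"
      by simp
    then show ?thesis
      by (simp add: algebra_simps diff_divide_distrib add_divide_distrib)
  qed
  have "A * D_t \<rho> (D_t \<rho> (in_coords \<rho> u \<xi>)) t + B * D_t \<rho> (in_coords \<rho> u \<xi>) t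
      + 1 / y * laplace_beltrami_sphere (\<lambda>\<eta>. in_coords \<rho> u \<eta> t) \<xi>
    = (\<Sum>k\<le>n. sqrt y ^ k / y * lap (H k) \<xi> - ?ev k * (sqrt y ^ k * H k \<xi>))"
    unfolding D1 D2 LB y(3) sum_distrib_left sum.distrib[symmetric] radial ..
  also have "\<dots> = (\<Sum>k\<le>n. residual \<gamma> n H k (?r t *\<^sub>R \<xi>)) - ?ev n * (\<Sum>k\<le>n. sqrt y ^ k * H k \<xi>)"
    unfolding sum_subtractf lap_sum hom_poly_scaleR[OF hom_poly_residual[OF H]] y(3)
    by (simp add: residual_def sum_distrib_left sum.distrib sum_subtractf algebra_simps)
  also have "\<dots> = - ?ev n * in_coords \<rho> u \<xi> t"
    using residual unfolding u[OF \<xi> t] y(3) by (simp add: mult.commute)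
  finally show ?thesis
    unfolding A_def B_def ball_eigenvalue_def y_def by (simp only: distrib_right add.assoc)
qed

end
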